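(* Let $S,K\subset\mathbb{R}$ be nonempty open bounded intervals and let $h>0$. Let $\mathbf{e}\in L^2(S,\mathbb{R}^2)$ and $M\ge 0$. The problem of finding $\phi_o\in L^2(K)$ with $\|\phi_o\|_{L^2(K)}\le M$ such that $$\|b_2^*[\phi_o]-\mathbf{e}\|_{L^2(S,\mathbb{R}^2)}=\min_{\phi\in L^2(K),\ \|\phi\|_{L^2(K)}\le M}\|b_2^*[\phi]-\mathbf{e}\|_{L^2(S,\mathbb{R}^2)}$$ admits a unique solution $\phi_o\in L^2(K)$. Moreover, if $\mathbf{e}\notin\operatorname{Ran} b_2^*$, then $\|\phi_o\|_{L^2(K)}=M$.
   Context: All $L^2(K)$ functions are real-valued, and $L^2(S,\mathbb{R}^2)$ carries the inner product $\langle (f_1,f_2),(g_1,g_2)\rangle=\langle f_1,g_1\rangle_{L^2(S)}+\langle f_2,g_2\rangle_{L^2(S)}$. For a bounded interval $I$ and $f\in L^2(I)$, $\widetilde f\in L^2(\mathbb{R})$ denotes the extension of $f$ by $0$ outside $I$. For $y>0$, $x\in\mathbb{R}$, $P_y(x)=\frac{1}{\pi}\frac{y}{x^2+y^2}$ and $Q_y(x)=\frac{1}{\pi}\frac{x}{x^2+y^2}$; $\star$ is convolution in $x\in\mathbb{R}$. The bounded operator $b_2:L^2(S,\mathbb{R}^2)\to L^2(K)$ is $b_2[(m_1,m_2)]=-\left[\partial_x\left(P_h\star\widetilde{m_1}-Q_h\star\widetilde{m_2}\right)\right]_{|K}$, and its adjoint is $b_2^*:L^2(K)\to L^2(S,\mathbb{R}^2)$,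 $b_2^*[\phi]=\left(\partial_x(P_h\star\widetilde\phi)_{|S},\ \partial_x(Q_h\star\widetilde\phi)_{|S}\right)$. *)

theory Defs
  imports "HOL-Analysis.Analysis"
begin

text \<open>Elements of \<open>L\<^sup>2(S)\<close> are represented by functions on the whole line of which only the
  values on \<open>S\<close> matter; equality of elements is equality almost everywhere on \<open>S\<close>.\<close>

definition L2 :: "real set \<Rightarrow> (real \<Rightarrow> 'a::euclidean_space) set" where
  "L2 S = {f. f \<in> borel_measurable (lebesgue_on S) \<and>
              integrable (lebesgue_on S) (\<lambda>x. (norm (f x))\<^sup>2)}"

definition L2_eq :: "real set \<Rightarrow> (real \<Rightarrow> 'a) \<Rightarrow> (real \<Rightarrow> 'a) \<Rightarrow> bool" where
  "L2_eq S f g \<longleftrightarrow> (AE x in lebesgue_on S. f x = g x)"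

text \<open>The inner product on \<^typ>\<open>real \<times> real\<close> is componentwise, so for pairs this is
  \<open>\<langle>f\<^sub>1, g\<^sub>1\<rangle> + \<langle>f\<^sub>2, g\<^sub>2\<rangle>\<close>.\<close>

definition L2_inner :: "real set \<Rightarrow> (real \<Rightarrow> 'a::euclidean_space) \<Rightarrow> (real \<Rightarrow> 'a) \<Rightarrow> real" where
  "L2_inner S f g = (LINT x|lebesgue_on S. f x \<bullet> g x)"

definition L2_norm :: "real set \<Rightarrow> (real \<Rightarrow> 'a::euclidean_space) \<Rightarrow> real" where
  "L2_norm S f = sqrt (L2_inner S f f)"

definition zero_ext :: "real set \<Rightarrow> (real \<Rightarrow> real) \<Rightarrow> real \<Rightarrow> real" where
  "zero_ext I f x = (if x \<in> I then f x else 0)"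

definition convolution :: "(real \<Rightarrow> real) \<Rightarrow> (real \<Rightarrow> real) \<Rightarrow> real \<Rightarrow> real" (infixl "\<star>" 70) where
  "(f \<star> g) x = (LINT t|lebesgue. f (x - t) * g t)"

definition poisson :: "real \<Rightarrow> real \<Rightarrow> real" where
  "poisson y x = 1 / pi * (y / (x\<^sup>2 + y\<^sup>2))"

definition conj_poisson :: "real \<Rightarrow> real \<Rightarrow> real" where
  "conj_poisson y x = 1 / pi * (x / (x\<^sup>2 + y\<^sup>2))"

text \<open>For \<open>h > 0\<close>, bounded \<open>K\<close> and \<open>\<phi> \<in> L2 K\<close> both convolutions are smooth on the whole line,
  so \<^const>\<open>deriv\<close> is the classical derivative at every point.\<close>

definition b2_adj :: "real \<Rightarrow> real set \<Rightarrow> (real \<Rightarrow> real) \<Rightarrow> real \<Rightarrow> real \<times> real" where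
  "b2_adj h K \<phi> x =
     (deriv (poisson h \<star> zero_ext K \<phi>) x, deriv (conj_poisson h \<star> zero_ext K \<phi>) x)"

definition Ran_b2_adj :: "real \<Rightarrow> real set \<Rightarrow> real set \<Rightarrow> (real \<Rightarrow> real \<times> real) set" where
  "Ran_b2_adj h S K = {f \<in> L2 S. \<exists>\<phi> \<in> L2 K. L2_eq S f (b2_adj h K \<phi>)}"

definition extremal_solution ::
    "real \<Rightarrow> real set \<Rightarrow> real set \<Rightarrow> (real \<Rightarrow> real \<times> real) \<Rightarrow> real \<Rightarrow> (real \<Rightarrow> real) \<Rightarrow> bool" where
  "extremal_solution h S K e M \<phi>o \<longleftrightarrow>
     is_arg_min (\<lambda>\<phi>. L2_norm S (\<lambda>x. b2_adj h K \<phi> x - e x))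
                (\<lambda>\<phi>. \<phi> \<in> L2 K \<and> L2_norm K \<phi> \<le> M) \<phi>o"

end

(* On the line Im z = h, b2_adj phi is, up to a rotation and the factor 1 / pi, the derivative of the
   Cauchy transform of phi.  If it vanishes on S, the identity theorem makes the Cauchy transform
   constant in the upper half-plane, hence 0 by its decay; so all moments of phi vanish and phi = 0.
   Together with the parallelogram law, this injectivity gives uniqueness.

   By Fubini, a function v orthogonal to the range of b2_adj yields a complex-valued function on S
   whose Cauchy transform has a derivative with vanishing real part on K + i h; Schwarz reflection
   and Liouville's theorem make this derivative 0, hence v = 0, and the range is dense.  A minimiser
   of norm less than M is an unconstrained critical point, so its residual is orthogonal to the
   range and therefore 0. *)

theory Submission
  imports Defs "HOL-Complex_Analysis.Complex_Analysis"
begin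

subsection \<open>Cauchy transforms of functions on the real line\<close>

text \<open>The overview takes a minimiser for granted. A minimising sequence in the ball need not
  converge in norm. Instead of weak compactness, an element of almost least norm is selected in each
  near-optimal set. These sets are closed under midpoints, so the parallelogram law makes the
  selected sequence Cauchy in L^2(K). A limit in L^1 suffices: on the line Im z = h one has |z - t|
  \<ge> h, so \<open>b2_adj h K \<phi>\<close> is bounded uniformly by a multiple of the L^1 norm of
  \<phi>, while Fatou's lemma keeps the limit in the ball.

  The two vanishing results start from different data. For injectivity the full complex kernel is
  zero on an interval, and the identity theorem applies at once. For density only its real part is
  known to be zero there, and reflection supplies the missing information. Both end with an
  integrable function on a bounded set all of whose moments are zero.\<close>

definition cauchy_transform :: "real set \<Rightarrow> (real \<Rightarrow> complex) \<Rightarrow> complex \<Rightarrow> complex" where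
  "cauchy_transform K w z = (LINT t|lebesgue_on K. w t / (z - of_real t))"

text \<open>Minus the complex derivative of \<open>cauchy_transform K w\<close> on the upper
  half-plane. It is the object that meets \<open>b2_adj\<close>, whose components are derivatives of
  convolutions.\<close>

definition cauchy_kernel2 :: "real set \<Rightarrow> (real \<Rightarrow> complex) \<Rightarrow> complex \<Rightarrow> complex" where
  "cauchy_kernel2 K w z = (LINT t|lebesgue_on K. w t / (z - of_real t)\<^sup>2)"

lemma Im_le_norm_diff_of_real: "Im z \<le> norm (z - of_real t)"
  using abs_Im_le_cmod[of "z - of_real t"] by simp

lemma of_real_borel_lebesgue_on: "(\<lambda>t. of_real t :: complex) \<in> borel_measurable (lebesgue_on K)"
proof -
  have "(\<lambda>t. of_real t :: complex) \<in> borel_measurable lebesgue"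
    by (intro borel_measurable_continuous_onI measurable_completion) (auto intro!: continuous_intros)
  then show ?thesis by (rule measurable_restrict_space1)
qed

lemma norm_cauchy_integrand_le:
  assumes "Im z > 0"
  shows "norm (a / (z - of_real t) ^ n) \<le> norm a / Im z ^ n"
  using assms Im_le_norm_diff_of_real[of z t]
  by (auto simp: norm_divide norm_power intro!: divide_left_mono power_mono mult_pos_pos zero_less_power)

lemma integrable_cauchy_integrand:
  assumes w: "integrable (lebesgue_on K) w" and z: "Im z > 0"
  shows "integrable (lebesgue_on K) (\<lambda>t. w t / (z - of_real t) ^ n)"
proof (rule Bochner_Integration.integrable_bound)
  show "integrable (lebesgue_on K) (\<lambda>t. norm (w t) / Im z ^ n)"
    using w by auto
  have [measurable]: "w \<in> borel_measurable (lebesgue_on K)"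
    using w by auto
  note of_real_borel_lebesgue_on[measurable]
  show "(\<lambda>t. w t / (z - of_real t) ^ n) \<in> borel_measurable (lebesgue_on K)"
    by measurable
  show "AE x in lebesgue_on K. norm (w x / (z - complex_of_real x) ^ n) \<le> norm (norm (w x) / Im z ^ n)"
    using z norm_cauchy_integrand_le[OF z] by (auto intro!: AE_I2)
qed

lemma norm_integral_cauchy_integrand_le:
  assumes w: "integrable (lebesgue_on K) w" and z: "Im z > 0"
  shows "norm (LINT t|lebesgue_on K. w t / (z - of_real t) ^ n) \<le> (LINT t|lebesgue_on K. norm (w t)) / Im z ^ n"
proof -
  have "norm (LINT t|lebesgue_on K. w t / (z - of_real t) ^ n)
      \<le> (LINT t|lebesgue_on K. norm (w t / (z - of_real t) ^ n))"
    by (rule integral_norm_bound)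
  also have "\<dots> \<le> (LINT t|lebesgue_on K. norm (w t) / Im z ^ n)"
    using norm_cauchy_integrand_le[OF z] integrable_cauchy_integrand[OF w z] w
    by (intro integral_mono) auto
  finally show ?thesis by simp
qed

lemma norm_cauchy_transform_le:
  assumes "integrable (lebesgue_on K) w" "Im z > 0"
  shows "norm (cauchy_transform K w z) \<le> (LINT t|lebesgue_on K. norm (w t)) / Im z"
  using norm_integral_cauchy_integrand_le[OF assms, of 1] by (simp add: cauchy_transform_def)

lemma norm_cauchy_kernel2_le:
  assumes "integrable (lebesgue_on K) w" "Im z > 0"
  shows "norm (cauchy_kernel2 K w z) \<le> (LINT t|lebesgue_on K. norm (w t)) / (Im z)\<^sup>2"
  using norm_integral_cauchy_integrand_le[OF assms, of 2] by (simp add: cauchy_kernel2_def)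

text \<open>The difference quotient of 1 / (z - t) differs from its derivative by exactly (u - z) /
  ((u - t) (z - t)^2). Integrated against \<open>w\<close>, this error is O(|u - z|).\<close>

lemma has_field_derivative_cauchy_transform:
  assumes w: "integrable (lebesgue_on K) w" and z: "Im z > 0"
  shows "(cauchy_transform K w has_field_derivative - cauchy_kernel2 K w z) (at z)"
proof -
  let ?M = "lebesgue_on K"
  define C where "C = (LINT t|?M. norm (w t))"
  have C: "C \<ge> 0" by (auto simp: C_def)
  \<comment> \<open>Restricting to Im u > Im z / 2 keeps |u - t| \<ge> Im z / 2, so the constant
    does not depend on \<open>u\<close>.\<close>
  have quotient: "norm ((cauchy_transform K w u - cauchy_transform K w z) / (u - z) + cauchy_kernel2 K w z)
      \<le> norm (u - z) * (C / (Im z / 2 * (Im z)\<^sup>2))" if u: "Im u > Im z / 2" "u \<noteq> z" for u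
  proof -
    have u0: "Im u > 0" using u z by linarith
    have int: "integrable ?M (\<lambda>t. w t / (u - of_real t))" "integrable ?M (\<lambda>t. w t / (z - of_real t))"
       "integrable ?M (\<lambda>t. w t / (z - of_real t)\<^sup>2)"
      using integrable_cauchy_integrand[OF w u0, of 1] integrable_cauchy_integrand[OF w z, of 1]
        integrable_cauchy_integrand[OF w z, of 2] by simp_all
    have pw: "(w t / (u - of_real t) - w t / (z - of_real t)) / (u - z) + w t / (z - of_real t)\<^sup>2
        = (u - z) * (w t / ((u - of_real t) * (z - of_real t)\<^sup>2))" for t
    proof -
      have "u - of_real t \<noteq> 0" "z - of_real t \<noteq> 0" "u - z \<noteq> 0"
        using Im_le_norm_diff_of_real[of u t] Im_le_norm_diff_of_real[of z t] u0 z u(2) by auto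
      then show ?thesis by (simp add: divide_simps power2_eq_square) (simp add: algebra_simps)
    qed
    have eq: "(cauchy_transform K w u - cauchy_transform K w z) / (u - z) + cauchy_kernel2 K w z
        = (LINT t|?M. (u - z) * (w t / ((u - of_real t) * (z - of_real t)\<^sup>2)))"
      unfolding cauchy_transform_def cauchy_kernel2_def using int
      by (subst pw[symmetric]) simp
    have "norm (LINT t|?M. (u - z) * (w t / ((u - of_real t) * (z - of_real t)\<^sup>2)))
      \<le> (LINT t|?M. norm (u - z) * (norm (w t) / (Im z / 2 * (Im z)\<^sup>2)))"
    proof (rule Bochner_Integration.integral_norm_bound_integral)
      show "integrable ?M (\<lambda>t. (u - z) * (w t / ((u - of_real t) * (z - of_real t)\<^sup>2)))"
        using int by (subst pw[symmetric]) auto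
      show "integrable ?M (\<lambda>t. norm (u - z) * (norm (w t) / (Im z / 2 * (Im z)\<^sup>2)))"
        using w by auto
      fix t
      have "Im z / 2 * (Im z)\<^sup>2 \<le> norm (u - of_real t) * (norm (z - of_real t))\<^sup>2"
        using Im_le_norm_diff_of_real[of u t] Im_le_norm_diff_of_real[of z t] u z
        by (intro mult_mono power_mono) auto
      then show "norm ((u - z) * (w t / ((u - of_real t) * (z - of_real t)\<^sup>2)))
        \<le> norm (u - z) * (norm (w t) / (Im z / 2 * (Im z)\<^sup>2))"
        unfolding norm_mult norm_divide norm_power using z
        by (intro mult_left_mono frac_le) auto
    qed
    also have "\<dots> = norm (u - z) * (C / (Im z / 2 * (Im z)\<^sup>2))"
      unfolding C_def by simp
    finally show ?thesis unfolding eq .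
  qed
  have "((\<lambda>u. (cauchy_transform K w u - cauchy_transform K w z) / (u - z) + cauchy_kernel2 K w z) \<longlongrightarrow> 0) (at z)"
  proof (rule Lim_null_comparison)
    have "((\<lambda>u. Im u) \<longlongrightarrow> Im z) (at z)" by (intro tendsto_intros)
    then have "eventually (\<lambda>u. Im u > Im z / 2) (at z)"
      using z by (intro order_tendstoD(1)) auto
    then show "eventually (\<lambda>u. norm ((cauchy_transform K w u - cauchy_transform K w z) / (u - z) + cauchy_kernel2 K w z)
      \<le> norm (u - z) * (C / (Im z / 2 * (Im z)\<^sup>2))) (at z)"
      using eventually_neq_at_within[of z z] by eventually_elim (use quotient in auto)
    show "((\<lambda>u. norm (u - z) * (C / (Im z / 2 * (Im z)\<^sup>2))) \<longlongrightarrow> 0) (at z)"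
      by (rule tendsto_eq_intros refl)+ simp
  qed
  from tendsto_add[OF this tendsto_const[of "- cauchy_kernel2 K w z"]]
  show ?thesis by (simp add: has_field_derivative_iff)
qed

lemma halfplanes_open_convex: "open {z. Im z > c}" "open {z. Im z < c}" "convex {z. Im z > c}" "convex {z. Im z < c}"
  by (auto simp: open_halfspace_Im_gt open_halfspace_Im_lt convex_halfspace_Im_gt convex_halfspace_Im_lt)

text \<open>Derivatives of holomorphic functions are holomorphic, so no second difference quotient
  has to be estimated.\<close>

lemma holomorphic_cauchy_kernel2:
  assumes "integrable (lebesgue_on K) w"
  shows "cauchy_kernel2 K w holomorphic_on {z. Im z > 0}"
proof -
  have "cauchy_transform K w holomorphic_on {z. Im z > 0}"
    using has_field_derivative_cauchy_transform[OF assms]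
    by (subst holomorphic_on_open) (auto simp: halfplanes_open_convex)
  then have "deriv (cauchy_transform K w) holomorphic_on {z. Im z > 0}"
    by (rule holomorphic_deriv) (rule halfplanes_open_convex)
  then have "(\<lambda>z. - deriv (cauchy_transform K w) z) holomorphic_on {z. Im z > 0}"
    by (rule holomorphic_on_minus)
  then show ?thesis
    by (rule holomorphic_transform)
      (use DERIV_imp_deriv[OF has_field_derivative_cauchy_transform[OF assms]] in auto)
qed

lemma integral_eq_0_of_cauchy_transform_eq_0:
  assumes w: "integrable (lebesgue_on K) w" and z: "\<And>z. Im z > 0 \<Longrightarrow> cauchy_transform K w z = 0"
  shows "(LINT t|lebesgue_on K. w t) = 0"
proof -
  let ?M = "lebesgue_on K"
  \<comment> \<open>Up the imaginary axis z C(z) tends to the integral of \<open>w\<close>, where C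
    is the Cauchy transform. There |z| = Im z \<le> |z - t|, so |w| itself dominates the integrands;
    \<open>Suc n\<close> keeps the points off the real line.\<close>
  define z where "z n = \<i> * of_real (real (Suc n))" for n
  have Imz: "Im (z n) > 0" for n by (simp add: z_def)
  have nz: "cmod (z n) = real (Suc n)" for n by (simp add: z_def norm_mult del: of_nat_Suc)
  have [measurable]: "w \<in> borel_measurable ?M" using w by auto
  note of_real_borel_lebesgue_on[measurable]
  have "(\<lambda>n. LINT t|?M. z n * (w t / (z n - of_real t))) \<longlonglongrightarrow> (LINT t|?M. w t)"
  proof (rule integral_dominated_convergence[where w = "\<lambda>t. norm (w t)"])
    show "integrable ?M (\<lambda>t. norm (w t))" using w by simp
    show "AE t in ?M. (\<lambda>n. z n * (w t / (z n - of_real t))) \<longlonglongrightarrow> w t"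
    proof (rule AE_I2)
      fix t
      have ne: "z n - of_real t \<noteq> 0" for n
        using Im_le_norm_diff_of_real[of "z n" t] Imz[of n] by auto
      have "(\<lambda>n. of_real t / (z n - of_real t)) \<longlonglongrightarrow> 0"
      proof (rule Lim_null_comparison)
        show "\<forall>\<^sub>F n in sequentially. norm (complex_of_real t / (z n - of_real t)) \<le> \<bar>t\<bar> / real (Suc n)"
        proof (rule always_eventually, rule allI)
          fix n
          have "real (Suc n) \<le> norm (z n - of_real t)"
            using Im_le_norm_diff_of_real[of "z n" t] by (simp add: z_def)
          then show "norm (complex_of_real t / (z n - of_real t)) \<le> \<bar>t\<bar> / real (Suc n)"
            unfolding norm_divide by (intro frac_le) auto
        qed
        show "(\<lambda>n. \<bar>t\<bar> / real (Suc n)) \<longlonglongrightarrow> 0"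
          using LIMSEQ_Suc[OF lim_const_over_n] .
      qed
      then have "(\<lambda>n. w t * (1 + of_real t / (z n - of_real t))) \<longlonglongrightarrow> w t * (1 + 0)"
        by (intro tendsto_intros)
      moreover have "w t * (1 + of_real t / (z n - of_real t)) = z n * (w t / (z n - of_real t))" for n
        using ne[of n] by (simp add: field_simps)
      ultimately show "(\<lambda>n. z n * (w t / (z n - of_real t))) \<longlonglongrightarrow> w t" by simp
    qed
    fix n
    show "AE t in ?M. norm (z n * (w t / (z n - of_real t))) \<le> norm (w t)"
    proof (rule AE_I2)
      fix t
      show "norm (z n * (w t / (z n - of_real t))) \<le> norm (w t)"
        using norm_cauchy_integrand_le[OF Imz[of n], of "w t" t 1] nz[of n]
        by (simp add: norm_mult z_def norm_divide field_simps del: of_nat_Suc)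
    qed
  qed auto
  moreover have "(LINT t|?M. z n * (w t / (z n - of_real t))) = z n * cauchy_transform K w (z n)" for n
    unfolding cauchy_transform_def by (rule integral_mult_right_zero)
  ultimately show ?thesis
    using z[OF Imz] by (simp add: LIMSEQ_const_iff)
qed

section \<open>Moments of a function with vanishing Cauchy transform\<close>

lemma integrable_mult_of_real_power:
  fixes w :: "real \<Rightarrow> complex"
  assumes "bounded K" "integrable (lebesgue_on K) w" "K \<in> sets lebesgue"
  shows "integrable (lebesgue_on K) (\<lambda>t. w t * of_real t ^ n)"
proof -
  obtain B where B: "\<And>t. t \<in> K \<Longrightarrow> \<bar>t\<bar> \<le> B"
    using assms(1) unfolding bounded_iff by auto
  have [measurable]: "w \<in> borel_measurable (lebesgue_on K)" using assms by auto
  note of_real_borel_lebesgue_on[measurable]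
  show ?thesis
  proof (rule Bochner_Integration.integrable_bound)
    show "integrable (lebesgue_on K) (\<lambda>t. norm (w t) * \<bar>B\<bar> ^ n)" using assms by auto
    have "cmod (w t) * \<bar>t\<bar> ^ n \<le> cmod (w t) * \<bar>B\<bar> ^ n" if "t \<in> K" for t
      using B[OF that] by (intro mult_left_mono power_mono) auto
    then show "AE t in lebesgue_on K. norm (w t * of_real t ^ n) \<le> norm (norm (w t) * \<bar>B\<bar> ^ n)"
      by (intro AE_I2) (auto simp: norm_mult norm_power)
  qed measurable
qed

text \<open>Since t / (z - t) = z / (z - t) - 1, multiplying \<open>w\<close> by t turns its
  transform C(z) into z C(z) minus the integral of \<open>w\<close>. Both terms vanish, so the
  hypothesis passes from each power of t to the next.\<close>

lemma moments_eq_0_of_cauchy_transform_eq_0: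
  assumes K: "bounded K" "K \<in> sets lebesgue"
    and w: "integrable (lebesgue_on K) w" and z: "\<And>z. Im z > 0 \<Longrightarrow> cauchy_transform K w z = 0"
  shows "(LINT t|lebesgue_on K. w t * of_real t ^ n) = 0"
proof -
  let ?u = "\<lambda>n t. w t * of_real t ^ n"
  have int: "integrable (lebesgue_on K) (?u n)" for n
    using integrable_mult_of_real_power[OF K(1) w K(2)] .
  have "Im z > 0 \<Longrightarrow> cauchy_transform K (?u n) z = 0" for z
  proof (induction n arbitrary: z)
    case 0
    then show ?case using z by simp
  next
    case (Suc n)
    have ne: "z - of_real t \<noteq> 0" for t
      using Im_le_norm_diff_of_real[of z t] Suc.prems by auto
    have "?u (Suc n) t / (z - of_real t) = z * (?u n t / (z - of_real t)) - ?u n t" for t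
      using ne[of t] by (simp add: field_simps)
    moreover have "integrable (lebesgue_on K) (\<lambda>t. z * (?u n t / (z - of_real t)))"
      using integrable_mult_right[OF integrable_cauchy_integrand[OF int[of n] Suc.prems, of 1], of z]
      by (simp only: power_one_right)
    ultimately have "cauchy_transform K (?u (Suc n)) z
        = z * cauchy_transform K (?u n) z - (LINT t|lebesgue_on K. ?u n t)"
      unfolding cauchy_transform_def using int[of n]
      by (simp only: Bochner_Integration.integral_diff integral_mult_right_zero)
    also have "\<dots> = 0"
      using Suc integral_eq_0_of_cauchy_transform_eq_0[OF int[of n]] by simp
    finally show ?case .
  qed
  then show ?thesis
    using integral_eq_0_of_cauchy_transform_eq_0[OF int[of n]] by simp
qed

lemma cauchy_transform_eq_0_of_kernel2:
  assumes w: "integrable (lebesgue_on K) w" and D: "\<And>z. Im z > 0 \<Longrightarrow> cauchy_kernel2 K w z = 0"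
    and z: "Im z > 0"
  shows "cauchy_transform K w z = 0"
proof -
  obtain c where c: "\<And>z. Im z > 0 \<Longrightarrow> cauchy_transform K w z = c"
  proof -
    have "\<exists>c. \<forall>z\<in>{z. Im z > 0}. cauchy_transform K w z = c"
    proof (rule has_field_derivative_zero_constant)
      show "(cauchy_transform K w has_field_derivative 0) (at z within {z. Im z > 0})" if "z \<in> {z. Im z > 0}" for z
        using has_field_derivative_cauchy_transform[OF w, of z] D[of z] that
        by (auto intro: has_field_derivative_at_within)
    qed (simp add: halfplanes_open_convex)
    then show ?thesis using that by auto
  qed
  let ?C = "LINT t|lebesgue_on K. norm (w t)"
  have "norm c \<le> 0"
  proof (rule LIMSEQ_le_const)
    show "(\<lambda>n. ?C / real (Suc n)) \<longlonglongrightarrow> 0" using LIMSEQ_Suc[OF lim_const_over_n] .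
    show "\<exists>N. \<forall>n\<ge>N. norm c \<le> ?C / real (Suc n)"
    proof (intro exI allI impI)
      fix n
      show "norm c \<le> ?C / real (Suc n)"
        using norm_cauchy_transform_le[OF w, of "\<i> * of_real (real (Suc n))"] c[of "\<i> * of_real (real (Suc n))"]
        by (simp del: of_nat_Suc)
    qed
  qed
  with c[OF z] show ?thesis by simp
qed

subsection \<open>Vanishing of the transform\<close>

text \<open>Polynomials approximate \<open>g\<close> uniformly on the compact closure of
  \<open>K\<close>, with an integral error of at most \<open>e\<close> times the L^1 norm of
  \<open>u\<close>.\<close>

lemma integral_mult_continuous_eq_0_of_moments:
  fixes u g :: "real \<Rightarrow> real"
  assumes K: "bounded K" "K \<in> sets lebesgue" and u: "integrable (lebesgue_on K) u"
    and moments: "\<And>n. (LINT t|lebesgue_on K. u t * t ^ n) = 0"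
    and int_pow: "\<And>n. integrable (lebesgue_on K) (\<lambda>t. u t * t ^ n)"
    and g: "continuous_on UNIV g"
    and int: "integrable (lebesgue_on K) (\<lambda>t. u t * g t)"
  shows "(LINT t|lebesgue_on K. u t * g t) = 0"
proof -
  let ?M = "lebesgue_on K"
  let ?C = "LINT t|?M. \<bar>u t\<bar>"
  have bound: "\<bar>LINT t|?M. u t * g t\<bar> \<le> e * ?C" if e: "e > 0" for e
  proof -
    have "compact (closure K)" using K(1) by (simp add: compact_closure)
    then obtain p where p: "real_polynomial_function p" "\<And>x. x \<in> closure K \<Longrightarrow> \<bar>g x - p x\<bar> < e"
      using Stone_Weierstrass_real_polynomial_function[OF _ continuous_on_subset[OF g subset_UNIV] e]
      by blast
    obtain a n where pa: "p = (\<lambda>x. \<Sum>i\<le>n. a i * x ^ i)"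
      using p(1) unfolding real_polynomial_function_iff_sum by blast
    have up: "u t * p t = (\<Sum>i\<le>n. a i * (u t * t ^ i))" for t
      by (simp add: pa sum_distrib_left mult_ac)
    have intp: "integrable ?M (\<lambda>t. u t * p t)"
      unfolding up using int_pow by (intro Bochner_Integration.integrable_sum integrable_mult_right)
    have "(LINT t|?M. u t * p t) = 0"
      unfolding up using int_pow moments by (subst Bochner_Integration.integral_sum) auto
    then have "\<bar>LINT t|?M. u t * g t\<bar> = norm (LINT t|?M. u t * g t - u t * p t)"
      using int intp by simp
    also have "\<dots> \<le> (LINT t|?M. e * \<bar>u t\<bar>)"
    proof (rule Bochner_Integration.integral_norm_bound_integral)
      fix t assume "t \<in> space ?M"
      then have "t \<in> closure K" using closure_subset[of K] by auto
      moreover have "u t * g t - u t * p t = (g t - p t) * u t" by (simp add: algebra_simps)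
      ultimately show "norm (u t * g t - u t * p t) \<le> e * \<bar>u t\<bar>"
        using mult_right_mono[OF less_imp_le[OF p(2)[of t]], of "\<bar>u t\<bar>"]
        by (simp add: abs_mult)
    qed (use int intp u in auto)
    finally show ?thesis by simp
  qed
  have "\<bar>LINT t|?M. u t * g t\<bar> \<le> 0"
  proof (rule field_le_epsilon)
    fix d :: real assume d: "d > 0"
    \<comment> \<open>The tolerance d / (?C + 1) yields an error of at most \<open>d\<close>; adding
      1 covers the case ?C = 0.\<close>
    have "?C \<ge> 0" by simp
    then have "?C + 1 > 0" by linarith
    then have "d / (?C + 1) * ?C \<le> d" using d by (simp add: pos_divide_le_eq distrib_left)
    moreover have "d / (?C + 1) > 0" using d \<open>?C + 1 > 0\<close> by (rule divide_pos_pos)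
    ultimately show "\<bar>LINT t|?M. u t * g t\<bar> \<le> 0 + d"
      using bound[of "d / (?C + 1)"] by linarith
  qed
  then show ?thesis by simp
qed

text \<open>The test function is u truncated to [-1, 1]: the product
  \<open>u t * clamp (u t)\<close> is integrable even if u^2 is not, is nonnegative, and vanishes
  only where \<open>u\<close> does. Measurability gives continuous functions converging to
  \<open>u\<close> almost everywhere. Truncating them keeps them continuous, and |u| dominates the
  resulting products.\<close>

lemma AE_eq_0_of_moments:
  fixes u :: "real \<Rightarrow> real"
  assumes K: "bounded K" "K \<in> sets lebesgue" and u: "integrable (lebesgue_on K) u"
    and moments: "\<And>n. (LINT t|lebesgue_on K. u t * t ^ n) = 0"
    and int_pow: "\<And>n. integrable (lebesgue_on K) (\<lambda>t. u t * t ^ n)"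
  shows "AE t in lebesgue_on K. u t = 0"
proof -
  let ?M = "lebesgue_on K"
  define clamp where "clamp x = max (-1) (min 1 x)" for x :: real
  have clamp: "\<bar>clamp x\<bar> \<le> 1" for x by (auto simp: clamp_def)
  have clamp_cont: "continuous_on UNIV clamp" unfolding clamp_def by (intro continuous_intros)
  have [measurable]: "clamp \<in> borel_measurable borel"
    by (intro borel_measurable_continuous_onI clamp_cont)
  have um[measurable]: "u \<in> borel_measurable ?M" using u by auto
  then have "u measurable_on K" using K(2) by (simp add: measurable_on_iff_borel_measurable)
  then obtain N g where N: "negligible N" and g: "\<And>n. continuous_on UNIV (g n :: real \<Rightarrow> real)"
    and lim: "\<And>x. x \<notin> N \<Longrightarrow> (\<lambda>n. g n x) \<longlonglongrightarrow> (if x \<in> K then u x else 0)"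
    unfolding measurable_on_def by blast
  have AE_N: "AE t in ?M. t \<notin> N"
  proof -
    have "AE t in lebesgue. t \<notin> N"
      using N by (intro AE_not_in) (simp add: negligible_iff_null_sets)
    then show ?thesis by (subst AE_restrict_space_iff) (use K(2) in auto)
  qed
  have gm: "(\<lambda>t. clamp (g n t)) \<in> borel_measurable ?M" for n
  proof -
    have "g n \<in> borel_measurable lebesgue"
      by (intro measurable_completion) (simp add: borel_measurable_continuous_onI g)
    then have [measurable]: "g n \<in> borel_measurable ?M" by (rule measurable_restrict_space1)
    show ?thesis by measurable
  qed
  have int_clamp: "integrable ?M (\<lambda>t. u t * clamp (f t))" if "(\<lambda>t. clamp (f t)) \<in> borel_measurable ?M" for f
  proof (rule Bochner_Integration.integrable_bound[OF u])
    show "AE t in ?M. norm (u t * clamp (f t)) \<le> norm (u t)"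
      using clamp by (auto simp: abs_mult mult_left_le)
    show "(\<lambda>t. u t * clamp (f t)) \<in> borel_measurable ?M"
      using um that by (rule borel_measurable_times)
  qed
  have "(\<lambda>n. LINT t|?M. u t * clamp (g n t)) \<longlonglongrightarrow> (LINT t|?M. u t * clamp (u t))"
  proof (rule integral_dominated_convergence[where w = "\<lambda>t. \<bar>u t\<bar>"])
    show "AE t in ?M. (\<lambda>n. u t * clamp (g n t)) \<longlonglongrightarrow> u t * clamp (u t)"
      using AE_N AE_space
    proof eventually_elim
      fix t assume "t \<notin> N" "t \<in> space ?M"
      then have "(\<lambda>n. g n t) \<longlonglongrightarrow> u t" using lim[of t] by auto
      then show "(\<lambda>n. u t * clamp (g n t)) \<longlonglongrightarrow> u t * clamp (u t)"
        unfolding clamp_def by (intro tendsto_intros)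
    qed
    show "AE t in ?M. norm (u t * clamp (g n t)) \<le> \<bar>u t\<bar>" for n
      using clamp by (auto simp: abs_mult mult_left_le)
    show "(\<lambda>t. u t * clamp (u t)) \<in> borel_measurable ?M" by measurable
    show "(\<lambda>t. u t * clamp (g n t)) \<in> borel_measurable ?M" for n
      using um gm by (rule borel_measurable_times)
  qed (use u in auto)
  moreover have "(LINT t|?M. u t * clamp (g n t)) = 0" for n
  proof (rule integral_mult_continuous_eq_0_of_moments[OF K u moments int_pow])
    show "continuous_on UNIV (\<lambda>t. clamp (g n t))"
      unfolding clamp_def by (intro continuous_intros g)
  qed (rule int_clamp[OF gm])
  ultimately have "(LINT t|?M. u t * clamp (u t)) = 0"
    by (simp add: LIMSEQ_const_iff)
  moreover have nonneg: "u t * clamp (u t) \<ge> 0" for t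
    by (auto simp: clamp_def max_def min_def mult_nonneg_nonneg mult_nonpos_nonpos)
  moreover have "integrable ?M (\<lambda>t. u t * clamp (u t))" by (rule int_clamp) measurable
  ultimately have "AE t in ?M. u t * clamp (u t) = 0"
    using integral_nonneg_eq_0_iff_AE by blast
  then show ?thesis
    by eventually_elim (auto simp: clamp_def max_def min_def split: if_splits)
qed

lemma AE_eq_0_of_cauchy_kernel2_eq_0:
  assumes K: "bounded K" "K \<in> sets lebesgue" and w: "integrable (lebesgue_on K) w"
    and D: "\<And>z. Im z > 0 \<Longrightarrow> cauchy_kernel2 K w z = 0"
  shows "AE t in lebesgue_on K. w t = 0"
proof -
  have int: "integrable (lebesgue_on K) (\<lambda>t. w t * of_real t ^ n)" for n
    by (rule integrable_mult_of_real_power[OF K(1) w K(2)])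
  have m: "(LINT t|lebesgue_on K. w t * of_real t ^ n) = 0" for n
    by (rule moments_eq_0_of_cauchy_transform_eq_0[OF K w cauchy_transform_eq_0_of_kernel2[OF w D]])
  have re: "Re (w t) * t ^ n = Re (w t * of_real t ^ n)" and im: "Im (w t) * t ^ n = Im (w t * of_real t ^ n)" for t n
    by (simp_all flip: of_real_power)
  have "AE t in lebesgue_on K. Re (w t) = 0"
    by (rule AE_eq_0_of_moments[OF K]) (use w int m in \<open>simp_all add: re integral_Re integrable_Re del: times_complex.sel\<close>)
  moreover have "AE t in lebesgue_on K. Im (w t) = 0"
    by (rule AE_eq_0_of_moments[OF K]) (use w int m in \<open>simp_all add: im integral_Im integrable_Im del: times_complex.sel\<close>)
  ultimately show ?thesis by eventually_elim (simp add: complex_eq_iff)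
qed

section \<open>Zeros on a horizontal line: identity theorem and reflection\<close>

lemma holomorphic_eq_0_of_real_segment:
  assumes f: "f holomorphic_on A" "open A" "connected A"
    and S: "open S" "S \<noteq> {}" and SA: "\<And>x. x \<in> S \<Longrightarrow> of_real x + c \<in> A"
    and z: "\<And>x. x \<in> S \<Longrightarrow> f (of_real x + c) = 0" and w: "w \<in> A"
  shows "f w = 0"
proof -
  obtain x0 where x0: "x0 \<in> S" using S by auto
  obtain r where r: "r > 0" "ball x0 r \<subseteq> S" using S x0 openE by blast
  have "(of_real x0 + c) islimpt ((\<lambda>x. of_real x + c) ` S)"
    unfolding islimpt_approachable
  proof (intro allI impI)
    fix e :: real assume e: "e > 0"
    \<comment> \<open>Half the minimum is positive, so the point is new, and below both
      \<open>r\<close> and \<open>e\<close>, so it lies in \<open>S\<close> and is close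
      enough.\<close>
    define x where "x = x0 + min r e / 2"
    have "x \<in> S" using r e by (intro subsetD[OF r(2)]) (auto simp: x_def dist_real_def)
    moreover have "dist (of_real x + c) (of_real x0 + c) < e" "of_real x + c \<noteq> of_real x0 + c"
      using e r by (auto simp: x_def dist_norm simp flip: of_real_diff)
    ultimately show "\<exists>x'\<in>(\<lambda>x. of_real x + c) ` S. x' \<noteq> of_real x0 + c \<and> dist x' (of_real x0 + c) < e"
      by auto
  qed
  then show ?thesis
    by (rule analytic_continuation[OF f _ SA[OF x0], rotated]) (use z w SA in auto)
qed

text \<open>The set where \<open>g\<close> is nonzero is open, and a nonempty open set is not
  negligible.\<close>

lemma continuous_AE_eq_0_imp_eq_0:
  fixes g :: "real \<Rightarrow> 'a::real_normed_vector"
  assumes S: "open S" and g: "continuous_on S g" and ae: "AE x in lebesgue_on S. g x = 0" and x: "x \<in> S"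
  shows "g x = 0"
proof (rule ccontr)
  assume "g x \<noteq> 0"
  define U where "U = {x \<in> S. g x \<noteq> 0}"
  have "U = S \<inter> g -` (- {0})" by (auto simp: U_def)
  then have "open U" using continuous_open_preimage[OF g S open_Compl[OF closed_singleton]] by simp
  moreover have "U \<noteq> {}" using x \<open>g x \<noteq> 0\<close> by (auto simp: U_def)
  moreover have "negligible U"
  proof -
    have "AE x in lebesgue. x \<in> S \<longrightarrow> g x = 0"
      using ae S by (subst (asm) AE_restrict_space_iff) auto
    then have "AE x in lebesgue. x \<notin> U" by eventually_elim (auto simp: U_def)
    moreover have "U \<in> sets lebesgue" using \<open>open U\<close> by auto
    ultimately show ?thesis by (simp add: AE_iff_null_sets negligible_iff_null_sets)
  qed
  ultimately show False using open_not_negligible by blast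
qed

lemma cauchy_kernel2_eq_0_of_AE:
  assumes w: "integrable (lebesgue_on K) w" and S: "open S" "S \<noteq> {}" and h: "h > 0"
    and ae: "AE x in lebesgue_on S. cauchy_kernel2 K w (of_real x + \<i> * of_real h) = 0"
    and z: "Im z > 0"
  shows "cauchy_kernel2 K w z = 0"
proof -
  note hol = holomorphic_cauchy_kernel2[OF w]
  have "continuous_on S (\<lambda>x. cauchy_kernel2 K w (of_real x + \<i> * of_real h))"
    using h by (intro continuous_on_compose2[OF holomorphic_on_imp_continuous_on[OF hol]] continuous_intros) auto
  then have zero: "cauchy_kernel2 K w (of_real x + \<i> * of_real h) = 0" if "x \<in> S" for x
    using continuous_AE_eq_0_imp_eq_0[OF S(1) _ ae that] by blast
  show ?thesis
    by (rule holomorphic_eq_0_of_real_segment[OF hol _ _ S _ zero])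
       (use z h in \<open>simp_all add: halfplanes_open_convex convex_connected\<close>)
qed

text \<open>By Schwarz reflection, \<open>z \<mapsto> D (z + \<i> h)\<close> continues to an entire function that is bounded
  and tends to \<open>0\<close> along the imaginary axis, where \<open>D = cauchy_kernel2 S w\<close>.\<close>

lemma cauchy_kernel2_eq_0_of_Re:
  assumes w: "integrable (lebesgue_on S) w" and K: "open K" "K \<noteq> {}" and h: "h > 0"
    and re: "\<And>t. t \<in> K \<Longrightarrow> Re (cauchy_kernel2 S w (of_real t + \<i> * of_real h)) = 0"
    and z: "Im z > 0"
  shows "cauchy_kernel2 S w z = 0"
proof -
  let ?C = "LINT t|lebesgue_on S. norm (w t)"
  define F where "F \<zeta> = cauchy_kernel2 S w (\<zeta> + \<i> * of_real h)" for \<zeta>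
  \<comment> \<open>The minus sign fits the data: a vanishing real part on \<open>K\<close> means F
    = - cnj F there, so F and G agree on \<open>K\<close>.\<close>
  define G where "G \<zeta> = - cnj (F (cnj \<zeta>))" for \<zeta>
  \<comment> \<open>F lives on the upper half-plane shifted down by \<open>h\<close>, G on its
    mirror image. They overlap in the strip |Im z| < h, which is connected and contains the real
    line.\<close>
  define A B where "A = {z. Im z > - h}" and "B = {z. Im z < h}"
  have AB: "open A" "open B" "convex A" "convex B" by (auto simp: A_def B_def halfplanes_open_convex)
  have F: "F holomorphic_on A"
    unfolding F_def A_def
    by (rule holomorphic_on_compose[OF _ holomorphic_on_subset[OF holomorphic_cauchy_kernel2[OF w]], unfolded o_def])
       (auto intro!: holomorphic_intros)
  have cnjB: "cnj ` B = A" unfolding image_cnj_conv_vimage_cnj by (auto simp: A_def B_def)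
  have G: "G holomorphic_on B"
    unfolding G_def
    by (rule holomorphic_on_minus, rule holomorphic_on_compose_cnj_cnj[unfolded o_def]) (simp_all add: cnjB F AB)
  have FG: "F \<zeta> = G \<zeta>" if "\<zeta> \<in> A \<inter> B" for \<zeta>
  proof -
    have "(\<lambda>z. F z - G z) holomorphic_on (A \<inter> B)"
      using F G by (intro holomorphic_on_diff) (auto elim: holomorphic_on_subset)
    then have "F \<zeta> - G \<zeta> = 0"
    proof (rule holomorphic_eq_0_of_real_segment[OF _ _ _ K, where c = 0])
      show "F (of_real x + 0) - G (of_real x + 0) = 0" if "x \<in> K" for x
        using re[OF that] by (simp add: F_def G_def complex_eq_iff)
    qed (use that AB h in \<open>auto intro!: convex_connected convex_Int simp: A_def B_def\<close>)
    then show ?thesis by simp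
  qed
  define E where "E \<zeta> = (if \<zeta> \<in> A then F \<zeta> else G \<zeta>)" for \<zeta>
  have "E holomorphic_on (A \<union> B)"
    unfolding E_def using F G AB FG by (intro holomorphic_on_If_Un) auto
  moreover have UN: "A \<union> B = UNIV" using h by (auto simp: A_def B_def)
  ultimately have E: "E holomorphic_on UNIV" by simp
  \<comment> \<open>The bound degenerates as Im \<zeta> tends to -h, so F is estimated only for Im
    \<zeta> \<ge> 0. Below the real axis the extension equals G, whose modulus is that of F at the
    conjugate point.\<close>
  have Fb: "norm (F \<zeta>) \<le> ?C / (Im \<zeta> + h)\<^sup>2" if "Im \<zeta> \<ge> 0" for \<zeta>
    using norm_cauchy_kernel2_le[OF w, of "\<zeta> + \<i> * of_real h"] that h by (simp add: F_def)
  have Fb': "norm (F \<zeta>) \<le> ?C / h\<^sup>2" if "Im \<zeta> \<ge> 0" for \<zeta>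
    using that h by (intro order_trans[OF Fb[OF that]] divide_left_mono power_mono mult_pos_pos zero_less_power) auto
  have "norm (E \<zeta>) \<le> ?C / h\<^sup>2" for \<zeta>
  proof (cases "Im \<zeta> \<ge> 0")
    case True
    then show ?thesis using Fb' h by (simp add: E_def A_def)
  next
    case False
    then have "\<zeta> \<in> B" using h by (auto simp: B_def)
    then have "E \<zeta> = G \<zeta>" using FG by (auto simp: E_def)
    then show ?thesis using Fb'[of "cnj \<zeta>"] False by (simp add: G_def)
  qed
  then have "bounded (range E)" by (auto simp: bounded_iff)
  from Liouville_theorem[OF E this] obtain c where c: "\<And>\<zeta>. E \<zeta> = c" by (auto simp: constant_on_def)
  have "norm c \<le> 0"
  proof (rule LIMSEQ_le_const)
    show "(\<lambda>n. ?C / real (Suc n)) \<longlonglongrightarrow> 0" using LIMSEQ_Suc[OF lim_const_over_n] .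
    have "norm c \<le> ?C / real (Suc n)" for n
    proof -
      have "norm c \<le> ?C / (real (Suc n) + h)\<^sup>2"
        using Fb[of "\<i> * of_real (real (Suc n))"] c[of "\<i> * of_real (real (Suc n))"] h
        by (simp add: E_def A_def)
      also have "\<dots> \<le> ?C / real (Suc n)"
      proof (rule divide_left_mono)
        have "real (Suc n) * 1 \<le> (real (Suc n) + h) * (real (Suc n) + h)"
          using h by (intro mult_mono) auto
        then show "real (Suc n) \<le> (real (Suc n) + h)\<^sup>2" by (simp add: power2_eq_square)
      qed (use h in auto)
      finally show ?thesis .
    qed
    then show "\<exists>N. \<forall>n\<ge>N. norm c \<le> ?C / real (Suc n)" by blast
  qed
  then have "E (z - \<i> * of_real h) = 0" using c by simp
  then show ?thesis using z by (simp add: E_def A_def F_def)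
qed

subsection \<open>Square-integrable functions\<close>

lemma L2_measurable: "f \<in> L2 S \<Longrightarrow> f \<in> borel_measurable (lebesgue_on S)"
  and L2_integrable_norm_sq: "f \<in> L2 S \<Longrightarrow> integrable (lebesgue_on S) (\<lambda>x. (norm (f x))\<^sup>2)"
  by (auto simp: L2_def)

text \<open>A bounded open set has finite measure, so L^2 lies in L^1; integrability is what the
  Cauchy transform lemmas ask for.\<close>

lemma L2_integrable:
  assumes "bounded S" "open S" and f: "f \<in> L2 S"
  shows "integrable (lebesgue_on S) f"
proof -
  interpret finite_measure "lebesgue_on S"
    using assms by (intro finite_measure_lebesgue_on lmeasurable_open)
  note [measurable] = L2_measurable[OF f]
  have "integrable (lebesgue_on S) (\<lambda>x. norm (f x))"
    by (rule square_integrable_imp_integrable) (use L2_integrable_norm_sq[OF f] in auto)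
  then show ?thesis by (rule integrable_norm_cancel) measurable
qed

lemma L2_integrable_inner:
  assumes f: "f \<in> L2 S" and g: "g \<in> L2 S"
  shows "integrable (lebesgue_on S) (\<lambda>x. f x \<bullet> g x)"
proof (rule Bochner_Integration.integrable_bound)
  note [measurable] = L2_measurable[OF f] L2_measurable[OF g]
  show "integrable (lebesgue_on S) (\<lambda>x. (norm (f x))\<^sup>2 + (norm (g x))\<^sup>2)"
    using assms by (intro Bochner_Integration.integrable_add L2_integrable_norm_sq)
  show "AE x in lebesgue_on S. norm (f x \<bullet> g x) \<le> norm ((norm (f x))\<^sup>2 + (norm (g x))\<^sup>2)"
  proof (rule AE_I2)
    fix x
    have "\<bar>f x \<bullet> g x\<bar> \<le> norm (f x) * norm (g x)" by (rule Cauchy_Schwarz_ineq2)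
    also have "\<dots> \<le> (norm (f x))\<^sup>2 + (norm (g x))\<^sup>2"
      using sum_squares_bound[of "norm (f x)" "norm (g x)"] mult_nonneg_nonneg[of "norm (f x)" "norm (g x)"]
      by (simp del: mult_nonneg_nonneg)
    finally show "norm (f x \<bullet> g x) \<le> norm ((norm (f x))\<^sup>2 + (norm (g x))\<^sup>2)" by simp
  qed
  show "(\<lambda>x. f x \<bullet> g x) \<in> borel_measurable (lebesgue_on S)" by measurable
qed

lemma inner_lincomb:
  fixes f g :: "'a::real_inner"
  shows "(a *\<^sub>R f + b *\<^sub>R g) \<bullet> (a *\<^sub>R f + b *\<^sub>R g) = a\<^sup>2 * (f \<bullet> f) + 2 * a * b * (f \<bullet> g) + b\<^sup>2 * (g \<bullet> g)"
  by (simp add: inner_add_left inner_add_right inner_commute[of g f] power2_eq_square algebra_simps)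

lemma L2_lincomb:
  assumes f: "f \<in> L2 S" and g: "g \<in> L2 S"
  shows "(\<lambda>x. a *\<^sub>R f x + b *\<^sub>R g x) \<in> L2 S"
proof -
  note [measurable] = L2_measurable[OF f] L2_measurable[OF g]
  have "integrable (lebesgue_on S) (\<lambda>x. (norm (a *\<^sub>R f x + b *\<^sub>R g x))\<^sup>2)"
    unfolding power2_norm_eq_inner inner_lincomb
    by (intro Bochner_Integration.integrable_add integrable_mult_right L2_integrable_inner f g)
  then show ?thesis by (simp add: L2_def)
qed

lemma L2_inner_lincomb:
  assumes f: "f \<in> L2 S" and g: "g \<in> L2 S"
  shows "L2_inner S (\<lambda>x. a *\<^sub>R f x + b *\<^sub>R g x) (\<lambda>x. a *\<^sub>R f x + b *\<^sub>R g x)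
    = a\<^sup>2 * L2_inner S f f + 2 * a * b * L2_inner S f g + b\<^sup>2 * L2_inner S g g"
  unfolding L2_inner_def inner_lincomb
  using L2_integrable_inner[OF f f] L2_integrable_inner[OF f g] L2_integrable_inner[OF g g] by simp

lemma L2_diff: "f \<in> L2 S \<Longrightarrow> g \<in> L2 S \<Longrightarrow> (\<lambda>x. f x - g x) \<in> L2 S"
  using L2_lincomb[of f S g 1 "-1"] by simp

lemma L2_midpoint: "f \<in> L2 S \<Longrightarrow> g \<in> L2 S \<Longrightarrow> (\<lambda>x. (1/2) *\<^sub>R f x + (1/2) *\<^sub>R g x) \<in> L2 S"
  by (rule L2_lincomb)

lemma L2_inner_nonneg: "0 \<le> L2_inner S f f"
  by (simp add: L2_inner_def)

text \<open>Written with the midpoint rather than the sum, because midpoints stay in the ball; the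
  factor 4 undoes the square of 1/2.\<close>

lemma L2_parallelogram:
  assumes "f \<in> L2 S" "g \<in> L2 S"
  shows "L2_inner S (\<lambda>x. f x - g x) (\<lambda>x. f x - g x) = 2 * L2_inner S f f + 2 * L2_inner S g g
    - 4 * L2_inner S (\<lambda>x. (1/2) *\<^sub>R f x + (1/2) *\<^sub>R g x) (\<lambda>x. (1/2) *\<^sub>R f x + (1/2) *\<^sub>R g x)"
  using L2_inner_lincomb[OF assms, of 1 "-1"] L2_inner_lincomb[OF assms, of "1/2" "1/2"]
  by (simp add: power2_eq_square)

text \<open>This makes both the ball in L^2(K) and the sublevel sets of the squared residual closed
  under midpoints.\<close>

lemma L2_inner_midpoint_le:
  assumes "f \<in> L2 S" "g \<in> L2 S"
  shows "L2_inner S (\<lambda>x. (1/2) *\<^sub>R f x + (1/2) *\<^sub>R g x) (\<lambda>x. (1/2) *\<^sub>R f x + (1/2) *\<^sub>R g x)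
    \<le> max (L2_inner S f f) (L2_inner S g g)"
  using L2_parallelogram[OF assms] L2_inner_nonneg[of S "\<lambda>x. f x - g x"] by linarith

lemma L2_inner_eq_0_imp_AE:
  assumes f: "f \<in> L2 S" and "L2_inner S f f = 0"
  shows "AE x in lebesgue_on S. f x = 0"
  using integral_nonneg_eq_0_iff_AE[OF L2_integrable_inner[OF f f]] assms(2) by (simp add: L2_inner_def)

section \<open>Limits in L^1 and the passage of L^2 bounds to the limit\<close>

lemma AE_summable_of_integral_bound:
  fixes g :: "nat \<Rightarrow> 'a \<Rightarrow> real"
  assumes g: "\<And>k. integrable M (g k)" and le: "\<And>k. (\<integral>x. \<bar>g k x\<bar> \<partial>M) \<le> c k" and c: "summable c"
  shows "AE x in M. summable (\<lambda>k. \<bar>g k x\<bar>)"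
    and "summable (\<lambda>k. \<integral>x. \<bar>g k x\<bar> \<partial>M)"
proof -
  show sm: "summable (\<lambda>k. \<integral>x. \<bar>g k x\<bar> \<partial>M)"
    by (rule summable_comparison_test'[OF c]) (use le in auto)
  have [measurable]: "g k \<in> borel_measurable M" for k using g by auto
  have "(\<integral>\<^sup>+x. (\<Sum>k. ennreal \<bar>g k x\<bar>) \<partial>M) = (\<Sum>k. \<integral>\<^sup>+x. ennreal \<bar>g k x\<bar> \<partial>M)"
    by (rule nn_integral_suminf) measurable
  also have "\<dots> = (\<Sum>k. ennreal (\<integral>x. \<bar>g k x\<bar> \<partial>M))"
    using g by (simp add: nn_integral_eq_integral)
  also have "\<dots> = ennreal (\<Sum>k. \<integral>x. \<bar>g k x\<bar> \<partial>M)"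
    by (rule suminf_ennreal2[OF _ sm]) simp
  finally have "(\<integral>\<^sup>+x. (\<Sum>k. ennreal \<bar>g k x\<bar>) \<partial>M) \<noteq> \<infinity>" by simp
  then have "AE x in M. (\<Sum>k. ennreal \<bar>g k x\<bar>) \<noteq> \<infinity>"
    by (intro nn_integral_PInf_AE) measurable
  then show "AE x in M. summable (\<lambda>k. \<bar>g k x\<bar>)"
    by eventually_elim (auto intro: summable_suminf_not_top)
qed

text \<open>The completeness argument of Riesz and Fischer in L^1: summable increments give an
  absolutely convergent telescoping series almost everywhere, together with an integrable
  majorant.\<close>

lemma dominated_subsequence_limit:
  fixes f :: "nat \<Rightarrow> 'a \<Rightarrow> real"
  assumes f: "\<And>k. integrable M (f k)"
    and le: "\<And>k. (\<integral>x. \<bar>f (Suc k) x - f k x\<bar> \<partial>M) \<le> c k" and c: "summable c"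
  obtains \<phi> where "\<phi> \<in> borel_measurable M" "AE x in M. (\<lambda>k. f k x) \<longlonglongrightarrow> \<phi> x"
    "(\<lambda>k. \<integral>x. \<bar>f k x - \<phi> x\<bar> \<partial>M) \<longlonglongrightarrow> 0"
proof -
  define g where "g k x = f (Suc k) x - f k x" for k x
  have g: "integrable M (g k)" for k unfolding g_def using f by auto
  have [measurable]: "f k \<in> borel_measurable M" for k using f by auto
  note sm = AE_summable_of_integral_bound[of M g, OF g le[folded g_def] c]
  define \<Phi> where "\<Phi> x = \<bar>f 0 x\<bar> + (\<Sum>k. \<bar>g k x\<bar>)" for x
  have int\<Phi>: "integrable M \<Phi>"
    unfolding \<Phi>_def using f g sm
    by (intro Bochner_Integration.integrable_add integrable_abs integrable_suminf) auto
  \<comment> \<open>Using \<open>lim\<close> everywhere yields a measurable function at once; its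
    value at points of divergence matters only on a null set.\<close>
  define \<phi> where "\<phi> x = lim (\<lambda>k. f k x)" for x
  have m\<phi>[measurable]: "\<phi> \<in> borel_measurable M" unfolding \<phi>_def by measurable
  have tele: "f k x = f 0 x + (\<Sum>i<k. g i x)" for k x
    by (induction k) (auto simp: g_def)
  have conv: "AE x in M. (\<lambda>k. f k x) \<longlonglongrightarrow> \<phi> x \<and> (\<forall>k. \<bar>f k x\<bar> \<le> \<Phi> x)"
    using sm(1)
  proof eventually_elim
    fix x assume s: "summable (\<lambda>k. \<bar>g k x\<bar>)"
    have "(\<lambda>k. f 0 x + (\<Sum>i<k. g i x)) \<longlonglongrightarrow> f 0 x + (\<Sum>i. g i x)"
      by (intro tendsto_intros summable_LIMSEQ summable_rabs_cancel[OF s])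
    then have "(\<lambda>k. f k x) \<longlonglongrightarrow> f 0 x + (\<Sum>i. g i x)" unfolding tele[symmetric] .
    then have "(\<lambda>k. f k x) \<longlonglongrightarrow> \<phi> x" unfolding \<phi>_def by (metis limI)
    moreover have "\<bar>f k x\<bar> \<le> \<Phi> x" for k
    proof -
      have "\<bar>f k x\<bar> \<le> \<bar>f 0 x\<bar> + (\<Sum>i<k. \<bar>g i x\<bar>)"
        unfolding tele[of k] by (rule order_trans[OF abs_triangle_ineq]) (simp add: sum_abs)
      also have "(\<Sum>i<k. \<bar>g i x\<bar>) \<le> (\<Sum>i. \<bar>g i x\<bar>)" by (rule sum_le_suminf[OF s]) auto
      finally show ?thesis by (simp add: \<Phi>_def)
    qed
    ultimately show "(\<lambda>k. f k x) \<longlonglongrightarrow> \<phi> x \<and> (\<forall>k. \<bar>f k x\<bar> \<le> \<Phi> x)" by blast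
  qed
  have "(\<lambda>k. \<integral>x. \<bar>f k x - \<phi> x\<bar> \<partial>M) \<longlonglongrightarrow> (\<integral>x. 0 \<partial>M)"
  proof (rule integral_dominated_convergence[where w = "\<lambda>x. 2 * \<Phi> x"])
    show "AE x in M. (\<lambda>k. \<bar>f k x - \<phi> x\<bar>) \<longlonglongrightarrow> 0"
      using conv by eventually_elim (auto intro: tendsto_rabs_zero LIM_zero)
    show "AE x in M. norm \<bar>f k x - \<phi> x\<bar> \<le> 2 * \<Phi> x" for k
      using conv
    proof eventually_elim
      fix x assume x: "(\<lambda>k. f k x) \<longlonglongrightarrow> \<phi> x \<and> (\<forall>k. \<bar>f k x\<bar> \<le> \<Phi> x)"
      then have "\<bar>\<phi> x\<bar> \<le> \<Phi> x" by (intro LIMSEQ_le_const2[OF tendsto_rabs]) auto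
      moreover have "\<bar>f k x\<bar> \<le> \<Phi> x" using x by blast
      ultimately show "norm \<bar>f k x - \<phi> x\<bar> \<le> 2 * \<Phi> x" by simp
    qed
  qed (use int\<Phi> in auto)
  with conv m\<phi> show ?thesis by (intro that[of \<phi>]) auto
qed

text \<open>Fatou's lemma for the squares: the limit stays in the ball although no L^2 convergence
  is assumed.\<close>

lemma L2_AE_limit:
  fixes f :: "nat \<Rightarrow> real \<Rightarrow> real"
  assumes f: "\<And>k. f k \<in> L2 K" and B: "\<And>k. L2_inner K (f k) (f k) \<le> B"
    and \<phi>: "\<phi> \<in> borel_measurable (lebesgue_on K)"
    and lim: "AE x in lebesgue_on K. (\<lambda>k. f k x) \<longlonglongrightarrow> \<phi> x"
  shows "\<phi> \<in> L2 K" "L2_inner K \<phi> \<phi> \<le> B"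
proof -
  let ?M = "lebesgue_on K"
  have B0: "0 \<le> B" using B[of 0] L2_inner_nonneg[of K "f 0"] by linarith
  note [measurable] = L2_measurable[OF f] \<phi>
  have nn: "(\<integral>\<^sup>+x. ennreal (f k x \<bullet> f k x) \<partial>?M) \<le> ennreal B" for k
    using B[of k] by (simp add: nn_integral_eq_integral[OF L2_integrable_inner[OF f f]] L2_inner_def ennreal_leI del: inner_real_def)
  have "(\<integral>\<^sup>+x. ennreal (\<phi> x \<bullet> \<phi> x) \<partial>?M) = (\<integral>\<^sup>+x. liminf (\<lambda>k. ennreal (f k x \<bullet> f k x)) \<partial>?M)"
  proof (rule nn_integral_cong_AE)
    show "AE x in ?M. ennreal (\<phi> x \<bullet> \<phi> x) = liminf (\<lambda>k. ennreal (f k x \<bullet> f k x))"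
      using lim
    proof eventually_elim
      fix x assume "(\<lambda>k. f k x) \<longlonglongrightarrow> \<phi> x"
      then have "(\<lambda>k. ennreal (f k x \<bullet> f k x)) \<longlonglongrightarrow> ennreal (\<phi> x \<bullet> \<phi> x)"
        by (intro tendsto_ennrealI tendsto_inner)
      then show "ennreal (\<phi> x \<bullet> \<phi> x) = liminf (\<lambda>k. ennreal (f k x \<bullet> f k x))"
        by (rule lim_imp_Liminf[OF sequentially_bot, symmetric])
    qed
  qed
  also have "\<dots> \<le> liminf (\<lambda>k. \<integral>\<^sup>+x. ennreal (f k x \<bullet> f k x) \<partial>?M)"
    by (rule nn_integral_liminf) measurable
  also have "\<dots> \<le> ennreal B" using nn by (intro Liminf_le) auto
  finally have le: "(\<integral>\<^sup>+x. ennreal (\<phi> x \<bullet> \<phi> x) \<partial>?M) \<le> ennreal B" .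
  have int: "integrable ?M (\<lambda>x. \<phi> x \<bullet> \<phi> x)"
    by (rule integrableI_nonneg) (use le in \<open>auto intro: le_less_trans\<close>)
  then show "\<phi> \<in> L2 K" using \<phi> by (simp add: L2_def power2_eq_square)
  show "L2_inner K \<phi> \<phi> \<le> B"
    using le nn_integral_eq_integral[OF int] B0 by (simp add: L2_inner_def)
qed

text \<open>The subsequence is chosen so fast that its increments are summable in L^1. Convergence
  in L^1 is the mode recorded, since it is the one that controls \<open>b2_adj\<close>.\<close>

lemma L2_bounded_Cauchy_subseq:
  fixes f :: "nat \<Rightarrow> real \<Rightarrow> real"
  assumes K: "bounded K" "open K" and f: "\<And>k. f k \<in> L2 K" and B: "\<And>k. L2_inner K (f k) (f k) \<le> B"
    and cauchy: "\<And>\<epsilon>. \<epsilon> > 0 \<Longrightarrow> \<exists>n0. \<forall>n\<ge>n0. \<forall>m\<ge>n. L2_inner K (\<lambda>x. f m x - f n x) (\<lambda>x. f m x - f n x) < \<epsilon>"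
  obtains \<phi> r where "\<phi> \<in> L2 K" "L2_inner K \<phi> \<phi> \<le> B" "strict_mono (r :: nat \<Rightarrow> nat)"
    "(\<lambda>k. LINT x|lebesgue_on K. \<bar>f (r k) x - \<phi> x\<bar>) \<longlonglongrightarrow> 0"
proof -
  let ?M = "lebesgue_on K"
  interpret finite_measure ?M
    using K by (intro finite_measure_lebesgue_on lmeasurable_open)
  have "\<exists>n0. \<forall>n\<ge>n0. \<forall>m\<ge>n. L2_inner K (\<lambda>x. f m x - f n x) (\<lambda>x. f m x - f n x) < (1/4)^k" for k
    by (rule cauchy) simp
  then obtain n0 where n0: "\<And>k n m. n0 k \<le> n \<Longrightarrow> n \<le> m \<Longrightarrow>
      L2_inner K (\<lambda>x. f m x - f n x) (\<lambda>x. f m x - f n x) < (1/4)^k"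
    by metis
  \<comment> \<open>\<open>Suc p\<close> forces strict growth, and \<open>n0 (Suc k)\<close> makes
    every later squared increment smaller than (1/4)^(k+1).\<close>
  define r where "r = rec_nat (n0 0) (\<lambda>k p. max (Suc p) (n0 (Suc k)))"
  have r_Suc: "r (Suc k) = max (Suc (r k)) (n0 (Suc k))" for k by (simp add: r_def)
  have r: "strict_mono r" by (intro strict_monoI_Suc) (simp add: r_Suc)
  have rn0: "n0 k \<le> r k" for k by (cases k) (auto simp: r_Suc, simp add: r_def)
  have int: "integrable ?M (f k)" for k by (rule L2_integrable[OF K f])
  \<comment> \<open>From |d| \<le> 2^(-k) + 2^k d^2: the first term integrates to 2^(-k) times the
    measure of \<open>K\<close>, and the second is at most 2^k 4^(-k) = 2^(-k). This is why the
    Cauchy threshold was (1/4)^k.\<close>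
  define c where "c k = (1/2)^k * (measure ?M (space ?M) + 1)" for k :: nat
  have le: "(LINT x|?M. \<bar>f (r (Suc k)) x - f (r k) x\<bar>) \<le> c k" for k
  proof -
    let ?d = "\<lambda>x. f (r (Suc k)) x - f (r k) x"
    have intd: "integrable ?M (\<lambda>x. ?d x \<bullet> ?d x)"
      by (rule L2_integrable_inner) (intro L2_diff f)+
    have "(LINT x|?M. \<bar>?d x\<bar>) \<le> (LINT x|?M. (1/2)^k + 2^k * (?d x \<bullet> ?d x))"
    proof (rule integral_mono)
      fix x
      have "2 * (2^k * \<bar>?d x\<bar>) \<le> 1 + (2^k * \<bar>?d x\<bar>)\<^sup>2"
        using sum_squares_bound[of 1 "2^k * \<bar>?d x\<bar>"] by simp
      then have "2^k * \<bar>?d x\<bar> \<le> 1 + (2^k * \<bar>?d x\<bar>)\<^sup>2"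
        using mult_nonneg_nonneg[of "2^k" "\<bar>?d x\<bar>"] by (simp del: mult_nonneg_nonneg)
      also have "\<dots> = 2^k * ((1/2)^k + 2^k * (?d x \<bullet> ?d x))"
        by (simp add: power2_eq_square algebra_simps flip: power_mult_distrib)
      finally show "\<bar>?d x\<bar> \<le> (1/2)^k + 2^k * (?d x \<bullet> ?d x)" by (rule mult_left_le_imp_le) simp
    qed (use int intd in auto)
    also have "\<dots> = (1/2)^k * measure ?M (space ?M) + 2^k * L2_inner K ?d ?d"
      using intd by (simp add: L2_inner_def del: inner_real_def)
    also have "\<dots> \<le> (1/2)^k * measure ?M (space ?M) + 2^k * (1/4)^k"
      using n0[OF rn0, of k "r (Suc k)"] strict_mono_leD[OF r, of k "Suc k"]
      by (intro add_left_mono mult_left_mono) auto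
    also have "2^k * (1/4)^k = ((1/2)^k :: real)" by (simp flip: power_mult_distrib)
    finally show ?thesis by (simp add: c_def algebra_simps)
  qed
  have "summable c" unfolding c_def by (intro summable_mult2 summable_geometric) simp
  from dominated_subsequence_limit[OF int le this]
  obtain \<phi> where \<phi>: "\<phi> \<in> borel_measurable ?M" "AE x in ?M. (\<lambda>k. f (r k) x) \<longlonglongrightarrow> \<phi> x"
    "(\<lambda>k. LINT x|?M. \<bar>f (r k) x - \<phi> x\<bar>) \<longlonglongrightarrow> 0" by blast
  from L2_AE_limit[OF f B \<phi>(1,2)] r \<phi>(3) show ?thesis by (intro that)
qed

subsection \<open>The operator as a Cauchy transform\<close>

lemma L2_integrable_of_real:
  assumes "bounded K" "open K" "\<phi> \<in> L2 K"
  shows "integrable (lebesgue_on K) (\<lambda>t. complex_of_real (\<phi> t))"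
  using L2_integrable[OF assms] by simp

lemma convolution_zero_ext:
  assumes "open K"
  shows "(f \<star> zero_ext K \<phi>) x = (LINT t|lebesgue_on K. f (x - t) * \<phi> t)"
  unfolding convolution_def using assms
  by (subst integral_restrict_space) (auto simp: zero_ext_def indicator_def intro!: Bochner_Integration.integral_cong)

lemma divide_Complex_diff:
  assumes "h > 0"
  shows "of_real a / (Complex x h - of_real t) =
    Complex (pi * (conj_poisson h (x - t) * a)) (- pi * (poisson h (x - t) * a))"
  using assms by (simp add: complex_eq_iff Re_divide Im_divide conj_poisson_def poisson_def)

lemma poisson_convolution_eq:
  assumes K: "bounded K" "open K" and h: "h > 0" and \<phi>: "\<phi> \<in> L2 K"
  shows "(poisson h \<star> zero_ext K \<phi>) x = - Im (cauchy_transform K (\<lambda>t. of_real (\<phi> t)) (Complex x h)) / pi"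
    and "(conj_poisson h \<star> zero_ext K \<phi>) x = Re (cauchy_transform K (\<lambda>t. of_real (\<phi> t)) (Complex x h)) / pi"
proof -
  have int: "integrable (lebesgue_on K) (\<lambda>t. of_real (\<phi> t) / (Complex x h - of_real t))"
    using integrable_cauchy_integrand[OF L2_integrable_of_real[OF K \<phi>], of "Complex x h" 1] h by simp
  have "Im (cauchy_transform K (\<lambda>t. of_real (\<phi> t)) (Complex x h)) = (LINT t|lebesgue_on K. - pi * (poisson h (x - t) * \<phi> t))"
    unfolding cauchy_transform_def integral_Im[OF int, symmetric]
    by (simp only: divide_Complex_diff[OF h] complex.sel)
  then show "(poisson h \<star> zero_ext K \<phi>) x = - Im (cauchy_transform K (\<lambda>t. of_real (\<phi> t)) (Complex x h)) / pi"
    unfolding convolution_zero_ext[OF K(2)] by simp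
  have "Re (cauchy_transform K (\<lambda>t. of_real (\<phi> t)) (Complex x h)) = (LINT t|lebesgue_on K. pi * (conj_poisson h (x - t) * \<phi> t))"
    unfolding cauchy_transform_def integral_Re[OF int, symmetric]
    by (simp only: divide_Complex_diff[OF h] complex.sel)
  then show "(conj_poisson h \<star> zero_ext K \<phi>) x = Re (cauchy_transform K (\<lambda>t. of_real (\<phi> t)) (Complex x h)) / pi"
    unfolding convolution_zero_ext[OF K(2)] by simp
qed

text \<open>On the line \<open>Im z = h\<close> the Cauchy transform of \<open>\<phi>\<close> is \<open>\<pi> (Q\<^sub>h - \<i> P\<^sub>h) \<star> \<phi>\<close>.\<close>

lemma b2_adj_eq:
  assumes K: "bounded K" "open K" and h: "h > 0" and \<phi>: "\<phi> \<in> L2 K"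
  shows "b2_adj h K \<phi> x =
    (Im (cauchy_kernel2 K (\<lambda>t. of_real (\<phi> t)) (Complex x h)) / pi,
     - Re (cauchy_kernel2 K (\<lambda>t. of_real (\<phi> t)) (Complex x h)) / pi)"
proof -
  let ?w = "\<lambda>t. complex_of_real (\<phi> t)"
  have "(Complex 0 h + of_real x) = Complex x h" for x by (simp add: complex_eq_iff)
  moreover have "((\<lambda>x. Complex 0 h + of_real x) has_vector_derivative 1) (at x)"
    by (auto intro!: derivative_eq_intros)
  ultimately have "((\<lambda>x. Complex x h) has_vector_derivative 1) (at x)" by simp
  from field_vector_diff_chain_at[OF this has_field_derivative_cauchy_transform[OF L2_integrable_of_real[OF K \<phi>]]] h
  have *: "((\<lambda>x. cauchy_transform K ?w (Complex x h)) has_vector_derivative - cauchy_kernel2 K ?w (Complex x h)) (at x)"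
    by (simp add: o_def)
  have "((\<lambda>x. Im (cauchy_transform K ?w (Complex x h))) has_real_derivative - Im (cauchy_kernel2 K ?w (Complex x h))) (at x)"
    using bounded_linear.has_vector_derivative[OF bounded_linear_Im *]
    by (simp add: has_real_derivative_iff_has_vector_derivative)
  then have "((poisson h \<star> zero_ext K \<phi>) has_real_derivative Im (cauchy_kernel2 K ?w (Complex x h)) / pi) (at x)"
    unfolding poisson_convolution_eq(1)[OF K h \<phi>, abs_def]
    using DERIV_cdivide[OF DERIV_minus, of _ _ x UNIV pi] by fastforce
  moreover have "((\<lambda>x. Re (cauchy_transform K ?w (Complex x h))) has_real_derivative - Re (cauchy_kernel2 K ?w (Complex x h))) (at x)"
    using bounded_linear.has_vector_derivative[OF bounded_linear_Re *]
    by (simp add: has_real_derivative_iff_has_vector_derivative)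
  then have "((conj_poisson h \<star> zero_ext K \<phi>) has_real_derivative - Re (cauchy_kernel2 K ?w (Complex x h)) / pi) (at x)"
    unfolding poisson_convolution_eq(2)[OF K h \<phi>, abs_def]
    by (rule DERIV_cdivide)
  ultimately show ?thesis by (auto simp: b2_adj_def intro!: DERIV_imp_deriv)
qed

lemma norm_b2_adj:
  assumes "bounded K" "open K" "h > 0" "\<phi> \<in> L2 K"
  shows "norm (b2_adj h K \<phi> x) = norm (cauchy_kernel2 K (\<lambda>t. of_real (\<phi> t)) (Complex x h)) / pi"
  unfolding b2_adj_eq[OF assms]
  by (simp add: norm_Pair cmod_def power_divide add.commute real_sqrt_divide flip: add_divide_distrib)

text \<open>The bound is uniform in \<open>x\<close> and involves only the L^1 norm of \<phi>. It
  puts \<open>b2_adj h K \<phi>\<close> in L^2(S) and turns L^1 convergence of the arguments into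
  uniform convergence of the images.\<close>

lemma norm_b2_adj_le:
  assumes "bounded K" "open K" "h > 0" "\<phi> \<in> L2 K"
  shows "norm (b2_adj h K \<phi> x) \<le> (LINT t|lebesgue_on K. \<bar>\<phi> t\<bar>) / h\<^sup>2 / pi"
  unfolding norm_b2_adj[OF assms]
  using norm_cauchy_kernel2_le[OF L2_integrable_of_real[OF assms(1,2,4)], of "Complex x h"] assms(3)
  by (intro divide_right_mono) auto

lemma b2_adj_lincomb:
  assumes K: "bounded K" "open K" and h: "h > 0" and \<phi>: "\<phi> \<in> L2 K" and \<psi>: "\<psi> \<in> L2 K"
  shows "b2_adj h K (\<lambda>t. a *\<^sub>R \<phi> t + b *\<^sub>R \<psi> t) x = a *\<^sub>R b2_adj h K \<phi> x + b *\<^sub>R b2_adj h K \<psi> x"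
proof -
  have Im: "Im (Complex x h) > 0" using h by simp
  have "cauchy_kernel2 K (\<lambda>t. of_real (a *\<^sub>R \<phi> t + b *\<^sub>R \<psi> t)) (Complex x h)
    = of_real a * cauchy_kernel2 K (\<lambda>t. of_real (\<phi> t)) (Complex x h) + of_real b * cauchy_kernel2 K (\<lambda>t. of_real (\<psi> t)) (Complex x h)"
    unfolding cauchy_kernel2_def
    using integrable_mult_right[OF integrable_cauchy_integrand[OF L2_integrable_of_real[OF K \<phi>] Im, of 2], of "of_real a"]
      integrable_mult_right[OF integrable_cauchy_integrand[OF L2_integrable_of_real[OF K \<psi>] Im, of 2], of "of_real b"]
    by (simp only: integral_mult_right_zero[symmetric] Bochner_Integration.integral_add[symmetric])
       (simp add: add_divide_distrib)
  then show ?thesis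
    unfolding b2_adj_eq[OF K h L2_lincomb[OF \<phi> \<psi>]] b2_adj_eq[OF K h \<phi>] b2_adj_eq[OF K h \<psi>]
    by (simp add: add_divide_distrib diff_divide_distrib)
qed

lemma b2_adj_diff:
  assumes "bounded K" "open K" "h > 0" "\<phi> \<in> L2 K" "\<psi> \<in> L2 K"
  shows "b2_adj h K (\<lambda>t. \<phi> t - \<psi> t) x = b2_adj h K \<phi> x - b2_adj h K \<psi> x"
  using b2_adj_lincomb[OF assms, of 1 "-1"] by simp

lemma continuous_on_cauchy_kernel2_line:
  assumes "integrable (lebesgue_on K) w" "h > 0"
  shows "continuous_on A (\<lambda>x. cauchy_kernel2 K w (Complex x h))"
proof -
  have "Complex x h = of_real x + \<i> * of_real h" for x by (simp add: complex_eq_iff)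
  then show ?thesis using assms(2)
    by (auto intro!: continuous_on_compose2[OF holomorphic_on_imp_continuous_on[OF holomorphic_cauchy_kernel2[OF assms(1)]]]
        continuous_intros)
qed

lemma L2_of_continuous_bounded:
  fixes f :: "real \<Rightarrow> 'a::euclidean_space"
  assumes S: "bounded S" "open S" and f: "continuous_on S f" and B: "\<And>x. norm (f x) \<le> B"
  shows "f \<in> L2 S"
proof -
  interpret finite_measure "lebesgue_on S"
    using S by (intro finite_measure_lebesgue_on lmeasurable_open)
  have m[measurable]: "f \<in> borel_measurable (lebesgue_on S)"
    using S by (intro continuous_imp_measurable_on_sets_lebesgue f) auto
  have "integrable (lebesgue_on S) (\<lambda>x. (norm (f x))\<^sup>2)"
    by (rule integrable_const_bound[of _ "B\<^sup>2"]) (use B in \<open>auto intro!: power_mono\<close>)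
  then show ?thesis using m by (simp add: L2_def)
qed

lemma b2_adj_in_L2:
  assumes "bounded K" "open K" "h > 0" "\<phi> \<in> L2 K" "bounded S" "open S"
  shows "b2_adj h K \<phi> \<in> L2 S"
proof (rule L2_of_continuous_bounded[OF assms(5,6) _ norm_b2_adj_le[OF assms(1-4)]])
  show "continuous_on S (b2_adj h K \<phi>)"
    unfolding b2_adj_eq[OF assms(1-4), abs_def]
    by (intro continuous_intros continuous_on_cauchy_kernel2_line L2_integrable_of_real assms) auto
qed

section \<open>Injectivity and dense range of the operator\<close>

lemma b2_adj_injective:
  assumes K: "bounded K" "open K" and h: "h > 0" and \<phi>: "\<phi> \<in> L2 K" and S: "open S" "S \<noteq> {}"
    and ae: "AE x in lebesgue_on S. b2_adj h K \<phi> x = 0"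
  shows "AE t in lebesgue_on K. \<phi> t = 0"
proof -
  have "AE x in lebesgue_on S. cauchy_kernel2 K (\<lambda>t. of_real (\<phi> t)) (of_real x + \<i> * of_real h) = 0"
    using ae
  proof eventually_elim
    fix x assume "b2_adj h K \<phi> x = 0"
    then have "cauchy_kernel2 K (\<lambda>t. of_real (\<phi> t)) (Complex x h) = 0"
      using norm_b2_adj[OF K h \<phi>, of x] by simp
    then show "cauchy_kernel2 K (\<lambda>t. of_real (\<phi> t)) (of_real x + \<i> * of_real h) = 0"
      by (simp add: Complex_eq)
  qed
  from cauchy_kernel2_eq_0_of_AE[OF L2_integrable_of_real[OF K \<phi>] S h this]
  have "AE t in lebesgue_on K. complex_of_real (\<phi> t) = 0"
    using K by (intro AE_eq_0_of_cauchy_kernel2_eq_0 L2_integrable_of_real \<phi>) auto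
  then show ?thesis by simp
qed

text \<open>The function is W = i (v_1 + i v_2). With D the second-order kernel of \<psi>, the
  product of v with \<open>b2_adj h K \<psi>\<close> is then Re (cnj W * D) / pi.\<close>

lemma integrable_Complex_swap:
  fixes v :: "'a \<Rightarrow> real \<times> real"
  assumes "integrable M v"
  shows "integrable M (\<lambda>x. Complex (- snd (v x)) (fst (v x)))"
proof -
  have "integrable M (\<lambda>x. of_real (- snd (v x)) + \<i> * of_real (fst (v x)))"
    using assms by (intro Bochner_Integration.integrable_add integrable_mult_right integrable_of_real
       Bochner_Integration.integrable_minus
       integrable_bounded_linear[OF bounded_linear_fst] integrable_bounded_linear[OF bounded_linear_snd])
  then show ?thesis by (simp add: Complex_eq)
qed

text \<open>This is the adjoint relation made explicit: Re (cauchy_kernel2 S W) / pi on the line Im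
  z = h is b_2[v]. It follows by Fubini, since the kernel is bounded by 1 / h^2 and both functions
  are integrable.\<close>

lemma L2_inner_b2_adj:
  fixes v :: "real \<Rightarrow> real \<times> real"
  assumes K: "bounded K" "open K" and h: "h > 0" and \<psi>: "\<psi> \<in> L2 K" and S: "bounded S" "open S" and v: "v \<in> L2 S"
  shows "L2_inner S v (b2_adj h K \<psi>) =
    (LINT t|lebesgue_on K. \<psi> t * Re (cauchy_kernel2 S (\<lambda>x. Complex (- snd (v x)) (fst (v x))) (Complex t h))) / pi"
proof -
  let ?M = "lebesgue_on S" and ?N = "lebesgue_on K"
  interpret M: finite_measure ?M using S by (intro finite_measure_lebesgue_on lmeasurable_open)
  interpret N: finite_measure ?N using K by (intro finite_measure_lebesgue_on lmeasurable_open)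
  interpret pair_sigma_finite ?M ?N ..
  define W where "W x = Complex (- snd (v x)) (fst (v x))" for x
  have W: "integrable ?M W"
    unfolding W_def by (rule integrable_Complex_swap[OF L2_integrable[OF S v]])
  then have cW: "integrable ?M (\<lambda>x. cnj (W x))" by simp
  have \<psi>': "integrable ?N \<psi>" by (rule L2_integrable[OF K \<psi>])
  have Imx: "Im (Complex x h) > 0" for x using h by simp
  define f where "f x t = cnj (W x) * (of_real (\<psi> t) / (Complex x h - of_real t)\<^sup>2)" for x t
  have intf: "integrable (?M \<Otimes>\<^sub>M ?N) (\<lambda>(x,t). f x t)"
  proof (rule Fubini_integrable)
    have m1: "(\<lambda>p. cnj (W (fst p))) \<in> borel_measurable (?M \<Otimes>\<^sub>M ?N)"
      by (rule measurable_compose[OF measurable_fst borel_measurable_integrable[OF cW]])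
    have m2: "(\<lambda>p. complex_of_real (\<psi> (snd p))) \<in> borel_measurable (?M \<Otimes>\<^sub>M ?N)"
      by (rule measurable_compose[OF measurable_snd]) (use L2_integrable_of_real[OF K \<psi>] in auto)
    have m3: "(\<lambda>p. complex_of_real (fst p)) \<in> borel_measurable (?M \<Otimes>\<^sub>M ?N)"
      by (rule measurable_compose[OF measurable_fst]) (rule of_real_borel_lebesgue_on)
    have m4: "(\<lambda>p. complex_of_real (snd p)) \<in> borel_measurable (?M \<Otimes>\<^sub>M ?N)"
      by (rule measurable_compose[OF measurable_snd]) (rule of_real_borel_lebesgue_on)
    note [measurable] = m1 m2 m3 m4
    show "(\<lambda>(x, t). f x t) \<in> borel_measurable (?M \<Otimes>\<^sub>M ?N)"
      unfolding f_def case_prod_beta Complex_eq by measurable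
    have int1: "integrable ?N (f x)" for x
      unfolding f_def
      by (intro integrable_mult_right integrable_cauchy_integrand L2_integrable_of_real K \<psi> Imx)
    then show "AE x in ?M. integrable ?N (\<lambda>t. case (x, t) of (x, t) \<Rightarrow> f x t)" by simp
    show "integrable ?M (\<lambda>x. LINT t|?N. norm (case (x, t) of (x, t) \<Rightarrow> f x t))"
    proof (rule Bochner_Integration.integrable_bound)
      show "integrable ?M (\<lambda>x. norm (W x) * ((LINT t|?N. \<bar>\<psi> t\<bar>) / h\<^sup>2))" using W by auto
      show "(\<lambda>x. LINT t|?N. norm (case (x, t) of (x, t) \<Rightarrow> f x t)) \<in> borel_measurable ?M"
        using \<open>(\<lambda>(x, t). f x t) \<in> borel_measurable (?M \<Otimes>\<^sub>M ?N)\<close>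
        by (intro N.borel_measurable_lebesgue_integral) auto
      show "AE x in ?M. norm (LINT t|?N. norm (case (x, t) of (x, t) \<Rightarrow> f x t))
          \<le> norm (norm (W x) * ((LINT t|?N. \<bar>\<psi> t\<bar>) / h\<^sup>2))"
      proof (rule AE_I2)
        fix x
        have "(LINT t|?N. norm (f x t)) \<le> (LINT t|?N. norm (W x) * (\<bar>\<psi> t\<bar> / h\<^sup>2))"
        proof (rule integral_mono)
          show "norm (f x t) \<le> norm (W x) * (\<bar>\<psi> t\<bar> / h\<^sup>2)" for t
            unfolding f_def norm_mult complex_mod_cnj
            using norm_cauchy_integrand_le[OF Imx, of "of_real (\<psi> t)" x t 2]
            by (intro mult_left_mono) auto
        qed (use int1 \<psi>' in auto)
        then show "norm (LINT t|?N. norm (case (x, t) of (x, t) \<Rightarrow> f x t))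
          \<le> norm (norm (W x) * ((LINT t|?N. \<bar>\<psi> t\<bar>) / h\<^sup>2))"
          by (simp add: abs_mult)
      qed
    qed
  qed
  have A: "(LINT t|?N. f x t) = cnj (W x) * cauchy_kernel2 K (\<lambda>t. of_real (\<psi> t)) (Complex x h)" for x
    unfolding f_def cauchy_kernel2_def by (rule integral_mult_right_zero)
  have B: "(LINT x|?M. f x t) = of_real (\<psi> t) * cnj (cauchy_kernel2 S W (Complex t h))" for t
  proof -
    \<comment> \<open>Exchanging \<open>x\<close> and \<open>t\<close> changes the base by a
      conjugation and a sign; the square removes the sign.\<close>
    have sq: "(Complex x h - of_real t)\<^sup>2 = cnj ((Complex t h - of_real x)\<^sup>2)" for x
    proof -
      have "Complex x h - of_real t = - cnj (Complex t h - of_real x)" by (simp add: complex_eq_iff)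
      then show ?thesis by (simp only: power2_minus complex_cnj_power)
    qed
    have "f x t = of_real (\<psi> t) * cnj (W x / (Complex t h - of_real x)\<^sup>2)" for x
      unfolding f_def sq complex_cnj_divide by simp
    then show ?thesis unfolding cauchy_kernel2_def
      by (simp only: integral_mult_right_zero Bochner_Integration.integral_cnj)
  qed
  have intA: "integrable ?M (\<lambda>x. LINT t|?N. f x t)" using integrable_fst[OF intf] by simp
  have intB: "integrable ?N (\<lambda>t. LINT x|?M. f x t)" using integrable_snd[OF intf] by simp
  have pw: "v x \<bullet> b2_adj h K \<psi> x = Re (LINT t|?N. f x t) / pi" for x
    unfolding A b2_adj_eq[OF K h \<psi>] W_def
    by (cases "v x") (simp add: diff_divide_distrib)
  have W_eq: "(\<lambda>x. Complex (- snd (v x)) (fst (v x))) = W" by (simp add: W_def fun_eq_iff)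
  have "L2_inner S v (b2_adj h K \<psi>) = (LINT x|?M. Re (LINT t|?N. f x t) / pi)"
    unfolding L2_inner_def pw ..
  also have "\<dots> = Re (LINT x|?M. (LINT t|?N. f x t)) / pi"
    by (simp only: integral_divide_zero integral_Re[OF intA])
  also have "(LINT x|?M. (LINT t|?N. f x t)) = (LINT t|?N. (LINT x|?M. f x t))"
    by (rule Fubini_integral[OF intf, symmetric])
  also have "Re \<dots> = (LINT t|?N. Re (LINT x|?M. f x t))"
    by (rule integral_Re[OF intB, symmetric])
  finally show ?thesis unfolding B W_eq by simp
qed

lemma dense_range_b2_adj:
  fixes v :: "real \<Rightarrow> real \<times> real"
  assumes K: "bounded K" "open K" "K \<noteq> {}" and h: "h > 0" and S: "bounded S" "open S" and v: "v \<in> L2 S"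
    and orth: "\<And>\<psi>. \<psi> \<in> L2 K \<Longrightarrow> L2_inner S v (b2_adj h K \<psi>) = 0"
  shows "AE x in lebesgue_on S. v x = 0"
proof -
  define W where "W x = Complex (- snd (v x)) (fst (v x))" for x
  have W: "integrable (lebesgue_on S) W"
    unfolding W_def by (rule integrable_Complex_swap[OF L2_integrable[OF S v]])
  \<comment> \<open>Orthogonality is tested against pi b_2[v] itself, which is continuous and
    bounded and hence admissible. Its squared norm is then 0, and continuity makes it vanish at
    every point of \<open>K\<close>.\<close>
  define \<psi> where "\<psi> t = Re (cauchy_kernel2 S W (Complex t h))" for t
  have c: "continuous_on K \<psi>"
    unfolding \<psi>_def by (intro continuous_intros continuous_on_cauchy_kernel2_line W h)
  have \<psi>: "\<psi> \<in> L2 K"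
  proof (rule L2_of_continuous_bounded[OF K(1,2) c])
    show "norm (\<psi> t) \<le> (LINT t|lebesgue_on S. norm (W t)) / h\<^sup>2" for t
      using norm_cauchy_kernel2_le[OF W, of "Complex t h"] h abs_Re_le_cmod[of "cauchy_kernel2 S W (Complex t h)"]
      by (simp add: \<psi>_def)
  qed
  have "L2_inner K \<psi> \<psi> = 0"
    using orth[OF \<psi>] L2_inner_b2_adj[OF K(1,2) h \<psi> S v]
    unfolding W_def[abs_def, symmetric] L2_inner_def[of K] \<psi>_def by simp
  from continuous_AE_eq_0_imp_eq_0[OF K(2) c L2_inner_eq_0_imp_AE[OF \<psi> this]]
  have "\<And>t. t \<in> K \<Longrightarrow> Re (cauchy_kernel2 S W (of_real t + \<i> * of_real h)) = 0"
    by (simp add: \<psi>_def Complex_eq)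
  from cauchy_kernel2_eq_0_of_Re[OF W K(2,3) h this]
  have "AE x in lebesgue_on S. W x = 0"
    using S by (intro AE_eq_0_of_cauchy_kernel2_eq_0 W) auto
  then show ?thesis by eventually_elim (auto simp: W_def complex_eq_iff prod_eq_iff)
qed

subsection \<open>The extremal problem\<close>

text \<open>Near-minimisers of \<open>N\<close> on the sublevel sets \<open>{x. R x \<le> d + 1 / (n + 1)}\<close>, where \<open>d\<close> is the
  infimum of \<open>R\<close>, form a Cauchy sequence by the parallelogram law.\<close>

lemma exists_minimizer_of_midpoint:
  fixes N R :: "'a \<Rightarrow> real" and D :: "'a \<Rightarrow> 'a \<Rightarrow> real" and mid :: "'a \<Rightarrow> 'a \<Rightarrow> 'a"
  assumes ne: "X \<noteq> {}"
    and R: "\<And>x. x \<in> X \<Longrightarrow> 0 \<le> R x"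
    and N: "\<And>x. x \<in> X \<Longrightarrow> 0 \<le> N x" "\<And>x. x \<in> X \<Longrightarrow> N x \<le> B"
    and mid: "\<And>x y. x \<in> X \<Longrightarrow> y \<in> X \<Longrightarrow> mid x y \<in> X"
    and Rmid: "\<And>x y. x \<in> X \<Longrightarrow> y \<in> X \<Longrightarrow> R (mid x y) \<le> max (R x) (R y)"
    and D: "\<And>x y. x \<in> X \<Longrightarrow> y \<in> X \<Longrightarrow> D x y \<le> 2 * N x + 2 * N y - 4 * N (mid x y)"
    and complete: "\<And>x :: nat \<Rightarrow> 'a. (\<And>n. x n \<in> X) \<Longrightarrow>
      (\<And>\<epsilon>. \<epsilon> > 0 \<Longrightarrow> \<exists>n0. \<forall>n\<ge>n0. \<forall>m\<ge>n. D (x m) (x n) < \<epsilon>) \<Longrightarrow>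
      \<exists>a\<in>X. \<exists>r. strict_mono r \<and> (\<lambda>n. R (x (r n))) \<longlonglongrightarrow> R a"
  shows "\<exists>a\<in>X. \<forall>y\<in>X. R a \<le> R y"
proof -
  define d where "d = Inf (R ` X)"
  have bddR: "bdd_below (R ` X)" using R by (auto intro!: bdd_belowI2[of _ 0])
  \<comment> \<open>The slack 1 / (n + 1) keeps these sets nonempty while it is still unknown
    whether the infimum is attained.\<close>
  define C where "C n = {x \<in> X. R x \<le> d + 1 / real (Suc n)}" for n
  have Cne: "C n \<noteq> {}" for n
  proof -
    obtain z where "z \<in> R ` X" "z < d + 1 / real (Suc n)"
      using cInf_lessD[of "R ` X" "d + 1 / real (Suc n)"] ne by (auto simp: d_def)
    then show ?thesis by (auto simp: C_def intro: less_imp_le)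
  qed
  have CX: "C n \<subseteq> X" for n by (auto simp: C_def)
  have Canti: "C m \<subseteq> C n" if "n \<le> m" for m n
  proof -
    have "1 / real (Suc m) \<le> 1 / real (Suc n)" using that by (intro divide_left_mono) auto
    then show ?thesis by (auto simp: C_def)
  qed
  \<comment> \<open>The sets shrink, so these infima increase; being bounded by \<open>B\<close>,
    they converge.\<close>
  define r where "r n = Inf (N ` C n)" for n
  have bddN: "bdd_below (N ` C n)" for n using N(1) CX by (auto intro!: bdd_belowI2[of _ 0])
  have rle: "r n \<le> N x" if "x \<in> C n" for n x
    unfolding r_def using that bddN by (intro cInf_lower) auto
  have "\<exists>x\<in>C n. N x < r n + 1 / real (Suc n)" for n
    using cInf_lessD[of "N ` C n" "r n + 1 / real (Suc n)"] Cne[of n] by (auto simp: r_def)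
  then obtain x where xC: "\<And>n. x n \<in> C n" and xN: "\<And>n. N (x n) < r n + 1 / real (Suc n)"
    by metis
  have xX: "x n \<in> X" for n using xC CX by auto
  have rmono: "incseq r"
  proof (rule incseq_SucI)
    fix n
    show "r n \<le> r (Suc n)"
      unfolding r_def using Canti[of n "Suc n"] Cne bddN by (intro cInf_superset_mono) auto
  qed
  moreover have "r n \<le> B" for n using rle[OF xC] N(2)[OF xX] order_trans by blast
  ultimately obtain L where L: "r \<longlonglongrightarrow> L" "\<And>n. r n \<le> L"
    using incseq_convergent[of r B] by blast
  \<comment> \<open>Both points and their midpoint lie in \<open>C n\<close>. Inserting N (x m) < L
    + 1 / (m + 1), N (x n) < r n + 1 / (n + 1) and N (mid) \<ge> r n into the parallelogram bound
    gives these constants.\<close>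
  have Dle: "D (x m) (x n) \<le> 2 * (L - r n) + 4 / real (Suc n)" if "n \<le> m" for m n
  proof -
    have "x m \<in> C n" using xC Canti[OF that] by auto
    with xC[of n] have "mid (x m) (x n) \<in> C n"
      using mid[OF xX xX, of m n] Rmid[OF xX xX, of m n] by (auto simp: C_def)
    then have "r n \<le> N (mid (x m) (x n))" by (rule rle)
    moreover have "1 / real (Suc m) \<le> 1 / real (Suc n)" using that by (intro divide_left_mono) auto
    ultimately show ?thesis
      using D[OF xX xX, of m n] xN[of m] xN[of n] L(2)[of m] by (simp add: add_divide_distrib)
  qed
  have lim: "(\<lambda>n. 2 * (L - r n) + 4 / real (Suc n)) \<longlonglongrightarrow> 2 * (L - L) + 0"
    by (intro tendsto_intros L(1) LIMSEQ_Suc[OF lim_const_over_n])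
  have "\<exists>n0. \<forall>n\<ge>n0. \<forall>m\<ge>n. D (x m) (x n) < \<epsilon>" if "\<epsilon> > 0" for \<epsilon>
  proof -
    have "eventually (\<lambda>n. 2 * (L - r n) + 4 / real (Suc n) < \<epsilon>) sequentially"
      using order_tendstoD(2)[OF lim] that by simp
    then show ?thesis unfolding eventually_sequentially using Dle by (meson le_less_trans)
  qed
  from complete[of x, OF xX this] obtain a s where a: "a \<in> X" "strict_mono s"
    and Ra: "(\<lambda>n. R (x (s n))) \<longlonglongrightarrow> R a" by blast
  have "(\<lambda>n. d + 1 / real (Suc n)) \<longlonglongrightarrow> d + 0"
    by (intro tendsto_intros LIMSEQ_Suc[OF lim_const_over_n])
  then have "(\<lambda>n. d + 1 / real (Suc (s n))) \<longlonglongrightarrow> d"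
    using LIMSEQ_subseq_LIMSEQ[OF _ a(2)] by (fastforce simp: o_def)
  then have "R a \<le> d"
    by (rule LIMSEQ_le[OF Ra]) (use xC in \<open>auto simp: C_def\<close>)
  moreover have "d \<le> R y" if "y \<in> X" for y unfolding d_def using that bddR by (intro cInf_lower) auto
  ultimately show ?thesis using a(1) by (intro bexI[of _ a] ballI) (rule order_trans)
qed

lemma L2_norm_le_iff: "M \<ge> 0 \<Longrightarrow> L2_norm K f \<le> M \<longleftrightarrow> L2_inner K f f \<le> M\<^sup>2"
  unfolding L2_norm_def by (metis L2_inner_nonneg abs_of_nonneg real_sqrt_abs real_sqrt_le_iff)

lemma L2_norm_eq_iff: "M \<ge> 0 \<Longrightarrow> L2_norm K f = M \<longleftrightarrow> L2_inner K f f = M\<^sup>2"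
  unfolding L2_norm_def by (metis L2_inner_nonneg abs_of_nonneg real_sqrt_abs real_sqrt_eq_iff)

text \<open>The residuals converge uniformly by \<open>norm_b2_adj_le\<close>. With \<open>A\<close>
  bounding the uniform distances, (a + A)^2 \<le> 2 a^2 + 2 A^2 provides the majorant for dominated
  convergence.\<close>

lemma L2_inner_residual_tendsto:
  assumes K: "bounded K" "open K" and h: "h > 0" and S: "bounded S" "open S" and e: "e \<in> L2 S"
    and f: "\<And>n. f n \<in> L2 K" and \<phi>: "\<phi> \<in> L2 K"
    and lim: "(\<lambda>n. LINT t|lebesgue_on K. \<bar>f n t - \<phi> t\<bar>) \<longlonglongrightarrow> 0"
  shows "(\<lambda>n. L2_inner S (\<lambda>x. b2_adj h K (f n) x - e x) (\<lambda>x. b2_adj h K (f n) x - e x))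
    \<longlonglongrightarrow> L2_inner S (\<lambda>x. b2_adj h K \<phi> x - e x) (\<lambda>x. b2_adj h K \<phi> x - e x)"
proof -
  interpret finite_measure "lebesgue_on S" using S by (intro finite_measure_lebesgue_on lmeasurable_open)
  define res where "res \<psi> x = b2_adj h K \<psi> x - e x" for \<psi> x
  define \<delta> where "\<delta> n = (LINT t|lebesgue_on K. \<bar>f n t - \<phi> t\<bar>) / h\<^sup>2 / pi" for n
  have res: "res \<psi> \<in> L2 S" if "\<psi> \<in> L2 K" for \<psi>
    unfolding res_def[abs_def] by (intro L2_diff b2_adj_in_L2 K h S e that)
  have \<delta>: "norm (res (f n) x - res \<phi> x) \<le> \<delta> n" for n x
    using norm_b2_adj_le[OF K h L2_diff[OF f \<phi>], of n x] by (simp add: res_def \<delta>_def b2_adj_diff[OF K h f \<phi>])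
  have "\<delta> \<longlonglongrightarrow> 0 / h\<^sup>2 / pi" unfolding \<delta>_def by (intro tendsto_intros lim) (use h in auto)
  then have \<delta>0: "\<delta> \<longlonglongrightarrow> 0" by simp
  then have "Bseq \<delta>" by (intro convergent_imp_Bseq convergentI)
  then obtain A where A: "\<And>n. \<bar>\<delta> n\<bar> \<le> A" unfolding Bseq_def by auto
  note [measurable] = L2_measurable[OF res[OF f]] L2_measurable[OF res[OF \<phi>]]
  have "(\<lambda>n. LINT x|lebesgue_on S. res (f n) x \<bullet> res (f n) x) \<longlonglongrightarrow> (LINT x|lebesgue_on S. res \<phi> x \<bullet> res \<phi> x)"
  proof (rule integral_dominated_convergence[where w = "\<lambda>x. 2 * (norm (res \<phi> x))\<^sup>2 + 2 * A\<^sup>2"])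
    show "integrable (lebesgue_on S) (\<lambda>x. 2 * (norm (res \<phi> x))\<^sup>2 + 2 * A\<^sup>2)"
      using L2_integrable_norm_sq[OF res[OF \<phi>]] by auto
    have "(\<lambda>n. res (f n) x - res \<phi> x) \<longlonglongrightarrow> 0" for x
      by (rule Lim_null_comparison[OF _ \<delta>0]) (use \<delta> in auto)
    then have "(\<lambda>n. res (f n) x) \<longlonglongrightarrow> res \<phi> x" for x by (rule LIM_zero_cancel)
    then show "AE x in lebesgue_on S. (\<lambda>n. res (f n) x \<bullet> res (f n) x) \<longlonglongrightarrow> res \<phi> x \<bullet> res \<phi> x"
      by (auto intro!: tendsto_inner)
    show "AE x in lebesgue_on S. norm (res (f n) x \<bullet> res (f n) x) \<le> 2 * (norm (res \<phi> x))\<^sup>2 + 2 * A\<^sup>2" for n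
    proof (rule AE_I2)
      fix x
      have "norm (res (f n) x) \<le> norm (res \<phi> x) + A"
        using norm_triangle_ineq2[of "res (f n) x" "res \<phi> x"] \<delta>[of n x] A[of n] by linarith
      then have "(norm (res (f n) x))\<^sup>2 \<le> (norm (res \<phi> x) + A)\<^sup>2" by (rule power_mono) simp
      also have "\<dots> \<le> 2 * (norm (res \<phi> x))\<^sup>2 + 2 * A\<^sup>2"
        using sum_squares_bound[of "norm (res \<phi> x)" A] by (simp add: power2_sum)
      finally show "norm (res (f n) x \<bullet> res (f n) x) \<le> 2 * (norm (res \<phi> x))\<^sup>2 + 2 * A\<^sup>2"
        by (simp add: power2_norm_eq_inner)
    qed
  qed measurable
  then show ?thesis unfolding L2_inner_def res_def .
qed

text \<open>The value at t = 0 is a local minimum, so the derivative 2 b there is zero.\<close>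

lemma quadratic_local_min_imp_linear_coeff_0:
  fixes a b c d :: real
  assumes d: "d > 0" and le: "\<And>t. \<bar>t\<bar> < d \<Longrightarrow> a \<le> a + 2 * t * b + t\<^sup>2 * c"
  shows "b = 0"
proof -
  have "((\<lambda>t. a + 2 * t * b + t\<^sup>2 * c) has_real_derivative 2 * b) (at 0)"
    by (auto intro!: derivative_eq_intros)
  from DERIV_local_min[OF this d] le show ?thesis by simp
qed

theorem proposition6:
  fixes S K :: "real set" and h M :: real and e :: "real \<Rightarrow> real \<times> real"
  assumes "is_interval S" "open S" "bounded S" "S \<noteq> {}"
    and "is_interval K" "open K" "bounded K" "K \<noteq> {}"
    and "h > 0"
    and "e \<in> L2 S"
    and "M \<ge> 0"
  shows "\<exists>\<phi>o. extremal_solution h S K e M \<phi>o \<and>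
           (\<forall>\<psi>. extremal_solution h S K e M \<psi> \<longrightarrow> L2_eq K \<psi> \<phi>o) \<and>
           (e \<notin> Ran_b2_adj h S K \<longrightarrow> L2_norm K \<phi>o = M)"
proof -
  note S = \<open>bounded S\<close> \<open>open S\<close> and K = \<open>bounded K\<close> \<open>open K\<close> and h = \<open>h > 0\<close> and e = \<open>e \<in> L2 S\<close>
  define res where "res \<psi> = (\<lambda>x. b2_adj h K \<psi> x - e x)" for \<psi>
  define R where "R \<psi> = L2_inner S (res \<psi>) (res \<psi>)" for \<psi>
  define N where "N \<psi> = L2_inner K \<psi> \<psi>" for \<psi> :: "real \<Rightarrow> real"
  define mid where "mid \<phi> \<psi> = (\<lambda>t. (1/2) *\<^sub>R \<phi> t + (1/2) *\<^sub>R \<psi> t)" for \<phi> \<psi> :: "real \<Rightarrow> real"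
  define X where "X = {\<phi> \<in> L2 K. N \<phi> \<le> M\<^sup>2}"
  have X_L2: "\<phi> \<in> L2 K" if "\<phi> \<in> X" for \<phi> using that by (simp add: X_def)
  have extremal_iff: "extremal_solution h S K e M \<phi> \<longleftrightarrow> \<phi> \<in> X \<and> (\<forall>\<psi>\<in>X. R \<phi> \<le> R \<psi>)" for \<phi>
    unfolding extremal_solution_def is_arg_min_def L2_norm_le_iff[OF \<open>M \<ge> 0\<close>]
    by (auto simp: X_def N_def R_def res_def L2_norm_def not_less)
  have b2: "b2_adj h K \<psi> \<in> L2 S" if "\<psi> \<in> L2 K" for \<psi> by (rule b2_adj_in_L2[OF K h that S])
  have res: "res \<psi> \<in> L2 S" if "\<psi> \<in> L2 K" for \<psi> unfolding res_def by (intro L2_diff b2 e that)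
  have mid: "mid \<phi> \<psi> \<in> X" if "\<phi> \<in> X" "\<psi> \<in> X" for \<phi> \<psi>
    using L2_inner_midpoint_le[of \<phi> K \<psi>] L2_midpoint[of \<phi> K \<psi>] that by (auto simp: X_def N_def mid_def)
  have res_mid: "res (mid \<phi> \<psi>) = (\<lambda>x. (1/2) *\<^sub>R res \<phi> x + (1/2) *\<^sub>R res \<psi> x)" if "\<phi> \<in> L2 K" "\<psi> \<in> L2 K" for \<phi> \<psi>
  proof
    fix x
    show "res (mid \<phi> \<psi>) x = (1/2) *\<^sub>R res \<phi> x + (1/2) *\<^sub>R res \<psi> x"
      unfolding res_def mid_def b2_adj_lincomb[OF K h that] by (simp add: scaleR_diff_right) (simp add: prod_eq_iff)
  qed
  have "\<exists>\<phi>\<in>X. \<forall>\<psi>\<in>X. R \<phi> \<le> R \<psi>"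
  proof (rule exists_minimizer_of_midpoint[where N = N and mid = mid and B = "M\<^sup>2"
        and D = "\<lambda>\<phi> \<psi>. N (\<lambda>t. \<phi> t - \<psi> t)"])
    have "(\<lambda>t. 0) \<in> X" by (simp add: X_def N_def L2_def L2_inner_def)
    then show "X \<noteq> {}" by auto
    show "R (mid \<phi> \<psi>) \<le> max (R \<phi>) (R \<psi>)" if "\<phi> \<in> X" "\<psi> \<in> X" for \<phi> \<psi>
      unfolding R_def res_mid[OF X_L2[OF that(1)] X_L2[OF that(2)]]
      by (rule L2_inner_midpoint_le) (intro res X_L2 that)+
    show "N (\<lambda>t. \<phi> t - \<psi> t) \<le> 2 * N \<phi> + 2 * N \<psi> - 4 * N (mid \<phi> \<psi>)" if "\<phi> \<in> X" "\<psi> \<in> X" for \<phi> \<psi>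
      unfolding N_def mid_def using L2_parallelogram[OF X_L2[OF that(1)] X_L2[OF that(2)]] by simp
    fix x :: "nat \<Rightarrow> real \<Rightarrow> real"
    assume x: "\<And>n. x n \<in> X"
      and cauchy: "\<And>\<epsilon>. \<epsilon> > 0 \<Longrightarrow> \<exists>n0. \<forall>n\<ge>n0. \<forall>m\<ge>n. N (\<lambda>t. x m t - x n t) < \<epsilon>"
    have xN: "L2_inner K (x n) (x n) \<le> M\<^sup>2" for n using x[of n] by (simp add: X_def N_def)
    obtain \<phi> r where \<phi>: "\<phi> \<in> L2 K" "L2_inner K \<phi> \<phi> \<le> M\<^sup>2" and r: "strict_mono (r :: nat \<Rightarrow> nat)"
      and lim: "(\<lambda>k. LINT t|lebesgue_on K. \<bar>x (r k) t - \<phi> t\<bar>) \<longlonglongrightarrow> 0"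
      using L2_bounded_Cauchy_subseq[OF K X_L2[OF x] xN cauchy[unfolded N_def]] by blast
    have "(\<lambda>k. R (x (r k))) \<longlonglongrightarrow> R \<phi>"
      unfolding R_def res_def by (rule L2_inner_residual_tendsto[OF K h S e X_L2[OF x] \<phi>(1) lim])
    moreover have "\<phi> \<in> X" using \<phi> by (simp add: X_def N_def)
    ultimately show "\<exists>a\<in>X. \<exists>r. strict_mono r \<and> (\<lambda>n. R (x (r n))) \<longlonglongrightarrow> R a" using r by blast
  qed (use mid in \<open>auto simp: R_def N_def X_def L2_inner_nonneg\<close>)
  then obtain \<phi> where \<phi>: "\<phi> \<in> X" and min: "\<And>\<psi>. \<psi> \<in> X \<Longrightarrow> R \<phi> \<le> R \<psi>" by blast
  have "L2_eq K \<psi> \<phi>" if "extremal_solution h S K e M \<psi>" for \<psi>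
  proof -
    have \<psi>: "\<psi> \<in> X" and "R \<psi> \<le> R \<phi>" using that \<phi> by (auto simp: extremal_iff)
    moreover have "R \<phi> \<le> R (mid \<psi> \<phi>)" by (intro min mid \<psi> \<phi>)
    \<comment> \<open>Since R \<psi> \<le> R \<phi> \<le> R (mid \<psi> \<phi>), the right-hand side
      2 R \<psi> + 2 R \<phi> - 4 R (mid \<psi> \<phi>) is at most 0.\<close>
    moreover note L2_parallelogram[OF res[OF X_L2[OF \<psi>]] res[OF X_L2[OF \<phi>]]]
    ultimately have "L2_inner S (\<lambda>x. res \<psi> x - res \<phi> x) (\<lambda>x. res \<psi> x - res \<phi> x) \<le> 0"
      unfolding R_def res_mid[OF X_L2[OF \<psi>] X_L2[OF \<phi>]] by linarith
    then have "AE x in lebesgue_on S. res \<psi> x - res \<phi> x = 0"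
      by (intro L2_inner_eq_0_imp_AE L2_diff res X_L2 \<psi> \<phi> antisym L2_inner_nonneg)
    then have "AE x in lebesgue_on S. b2_adj h K (\<lambda>t. \<psi> t - \<phi> t) x = 0"
      by eventually_elim (simp add: res_def b2_adj_diff[OF K h X_L2[OF \<psi>] X_L2[OF \<phi>]])
    then have "AE t in lebesgue_on K. \<psi> t - \<phi> t = 0"
      by (rule b2_adj_injective[OF K h L2_diff[OF X_L2[OF \<psi>] X_L2[OF \<phi>]] \<open>open S\<close> \<open>S \<noteq> {}\<close>])
    then show ?thesis by (simp add: L2_eq_def)
  qed
  moreover have "L2_norm K \<phi> = M" if "e \<notin> Ran_b2_adj h S K"
  proof (rule ccontr)
    assume "L2_norm K \<phi> \<noteq> M"
    with \<phi> have lt: "N \<phi> < M\<^sup>2" by (simp add: L2_norm_eq_iff[OF \<open>M \<ge> 0\<close>] X_def N_def)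
    have "L2_inner S (res \<phi>) (b2_adj h K \<psi>) = 0" if \<psi>: "\<psi> \<in> L2 K" for \<psi>
    proof -
      have pert: "(\<lambda>x. 1 *\<^sub>R \<phi> x + t *\<^sub>R \<psi> x) \<in> L2 K" for t by (intro L2_lincomb X_L2 \<phi> \<psi>)
      have N_pert: "N (\<lambda>x. 1 *\<^sub>R \<phi> x + t *\<^sub>R \<psi> x) = N \<phi> + 2 * t * L2_inner K \<phi> \<psi> + t\<^sup>2 * N \<psi>" for t
        unfolding N_def L2_inner_lincomb[OF X_L2[OF \<phi>] \<psi>] by simp
      have "res (\<lambda>x. 1 *\<^sub>R \<phi> x + t *\<^sub>R \<psi> x) = (\<lambda>x. 1 *\<^sub>R res \<phi> x + t *\<^sub>R b2_adj h K \<psi> x)" for t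
        unfolding res_def b2_adj_lincomb[OF K h X_L2[OF \<phi>] \<psi>] by (simp add: algebra_simps)
      then have R_pert: "R (\<lambda>x. 1 *\<^sub>R \<phi> x + t *\<^sub>R \<psi> x) = R \<phi> + 2 * t * L2_inner S (res \<phi>) (b2_adj h K \<psi>)
          + t\<^sup>2 * L2_inner S (b2_adj h K \<psi>) (b2_adj h K \<psi>)" for t
        unfolding R_def by (simp only: L2_inner_lincomb[OF res[OF X_L2[OF \<phi>]] b2[OF \<psi>]]) simp
      \<comment> \<open>The strict inequality N \<phi> < M^2 survives for all small \<open>t\<close>
        of either sign, so \<phi> may be moved both ways along \<psi> inside the ball.\<close>
      have "((\<lambda>t. N \<phi> + 2 * t * L2_inner K \<phi> \<psi> + t\<^sup>2 * N \<psi>) \<longlongrightarrow> N \<phi> + 2 * 0 * L2_inner K \<phi> \<psi> + 0\<^sup>2 * N \<psi>) (nhds 0)"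
        by (intro tendsto_intros filterlim_ident)
      then have "eventually (\<lambda>t. N \<phi> + 2 * t * L2_inner K \<phi> \<psi> + t\<^sup>2 * N \<psi> < M\<^sup>2) (nhds 0)"
        using lt by (intro order_tendstoD(2)) auto
      then obtain d where d: "d > 0" "\<And>t. \<bar>t\<bar> < d \<Longrightarrow> N \<phi> + 2 * t * L2_inner K \<phi> \<psi> + t\<^sup>2 * N \<psi> < M\<^sup>2"
        unfolding eventually_nhds_metric by auto
      have "R \<phi> \<le> R \<phi> + 2 * t * L2_inner S (res \<phi>) (b2_adj h K \<psi>)
          + t\<^sup>2 * L2_inner S (b2_adj h K \<psi>) (b2_adj h K \<psi>)" if "\<bar>t\<bar> < d" for t
        unfolding R_pert[symmetric]
        by (rule min) (use pert[of t] N_pert[of t] d(2)[OF that] in \<open>auto simp: X_def\<close>)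
      then show ?thesis by (rule quadratic_local_min_imp_linear_coeff_0[OF d(1)])
    qed
    then have "AE x in lebesgue_on S. res \<phi> x = 0"
      by (rule dense_range_b2_adj[OF K \<open>K \<noteq> {}\<close> h S res[OF X_L2[OF \<phi>]]])
    then have "L2_eq S e (b2_adj h K \<phi>)"
      unfolding L2_eq_def by eventually_elim (simp add: res_def)
    then show False using that e X_L2[OF \<phi>] by (auto simp: Ran_b2_adj_def)
  qed
  ultimately show ?thesis using \<phi> min extremal_iff by blast
qed

end
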